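(* Let $\epsilon\in(0,1)$, $p_\beta=(1-\epsilon)\delta_0+\epsilon g$, $G\sim g$, and suppose $\mathbb{E}|G|^2<\infty$. Then for every $1<q\le2$ and every $0<\delta<1$, $$\lim_{\sigma_w\to0}\mathrm{AMSE}(\lambda_{*,q},q,\sigma_w)>0$$ (with $q,\delta,p_\beta$ fixed).
   Context: Fix $\delta>0$, $\sigma_w>0$ and a probability measure $p_\beta$ on $\mathbb{R}$ with finite second moment. A converging sequence $\{\beta(p),X(p),w(p)\}_{p\ge1}$ consists of vectors $\beta(p)\in\mathbb{R}^p$, $w(p)\in\mathbb{R}^n$ (non-random) and random matrices $X(p)\in\mathbb{R}^{n\times p}$, with $n=n(p)$, $n/p\to\delta$, such that: (i) the empirical distribution of the entries of $\beta(p)$ converges weakly to $p_\beta$ and $\frac1p\|\beta(p)\|_2^2$ converges to the second moment of $p_\beta$; (ii) the empirical distribution of the entries of $w(p)$ converges weakly to a zero-mean distribution with variance $\sigma_w^2$ and $\frac1n\|w(p)\|_2^2\to\sigma_w^2$; (iii) the entries of $X(p)$ are i.i.d. $N(0,1/n)$. Put $y=X\beta+w$ and, for $\lambda\ge 0$, $q\in[1,2]$, let $\hat\beta(\lambda,q,p)\in\arg\min_{b\in\mathbb{R}^p}\frac12\|y-Xb\|_2^2+\lambda\|b\|_q^q$, where $\|b\|_q^q=\sum_i|b_i|^q$. The asymptotic mean square error $\mathrm{AMSE}(\lambda,q,\sigma_w)$ is the almost sure limit of $\frac1p\|\hat\beta(\lambda,q,p)-\beta(p)\|_2^2$ as $p\to\infty$.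 For $\lambda>0$ this limit exists and equals $\mathbb{E}(\eta_q(B+\bar\sigma Z;\bar\chi\bar\sigma^{2-q})-B)^2$, where $B\sim p_\beta$ and $Z\sim N(0,1)$ are independent, $\eta_q(u;\chi)=\arg\min_z\frac12(u-z)^2+\chi|z|^q$, and $(\bar\sigma,\bar\chi)$ is the unique pair of positive numbers with $\bar\sigma^2=\sigma_w^2+\frac1\delta\mathbb{E}(\eta_q(B+\bar\sigma Z;\bar\chi\bar\sigma^{2-q})-B)^2$ and $\lambda=\bar\chi\bar\sigma^{2-q}\big(1-\frac1\delta\mathbb{E}\,\partial_1\eta_q(B+\bar\sigma Z;\bar\chi\bar\sigma^{2-q})\big)$ ($\partial_1$ = derivative in the first argument). It depends on the sequence only through $\delta,p_\beta,\sigma_w$. $\lambda_{*,q}=\lambda_{*,q}(\sigma_w)$ denotes a value of $\lambda\ge0$ minimizing $\lambda\mapsto\mathrm{AMSE}(\lambda,q,\sigma_w)$. Standing assumption: $p_\beta=(1-\epsilon)\delta_0+\epsilon g$, where $\delta_0$ is the point mass at $0$, $\epsilon\in(0,1)$, and $g$ is a probability distribution on $\mathbb{R}$ with no point mass at $0$. *)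

theory Defs
  imports "HOL-Probability.Probability"
begin

text \<open>
  Vectors and matrices whose dimensions grow with \<open>p\<close> are functions on \<open>nat\<close>: the entries of a
  vector in dimension \<open>d\<close> are the values at indices below \<open>d\<close>, all other values are irrelevant.
  An instance consists of the sample sizes \<open>n(p)\<close>, the deterministic vectors \<open>\<beta>(p)\<close> and \<open>w(p)\<close>,
  a probability space, and the random matrices \<open>X(p)\<close>, with entries \<open>dsg I p j i\<close> for
  \<open>j < n(p)\<close> (row) and \<open>i < p\<close> (column). Nothing is prescribed about the joint law of
  \<open>X(p)\<close> for different \<open>p\<close>.
\<close>

record 'w lq_instance =
  nobs :: "nat \<Rightarrow> nat"
  sig :: "nat \<Rightarrow> nat \<Rightarrow> real"
  noise :: "nat \<Rightarrow> nat \<Rightarrow> real"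
  pspace :: "'w measure"
  dsg :: "nat \<Rightarrow> nat \<Rightarrow> nat \<Rightarrow> 'w \<Rightarrow> real"

definition empirical :: "nat \<Rightarrow> (nat \<Rightarrow> real) \<Rightarrow> real measure" where
  "empirical d v = distr (uniform_count_measure {..<d}) borel v"

text \<open>\<open>sw\<close> is the standard deviation \<open>\<sigma>\<^sub>w\<close> of the noise; the second parameter of
  \<^const>\<open>normal_density\<close> is a standard deviation as well.\<close>

definition converging_sequence :: "real \<Rightarrow> real measure \<Rightarrow> real \<Rightarrow> 'w lq_instance \<Rightarrow> bool" where
  "converging_sequence \<delta> pb sw I \<longleftrightarrow>
     (\<lambda>p. real (nobs I p) / real p) \<longlonglongrightarrow> \<delta> \<and>
     weak_conv_m (\<lambda>p. empirical p (sig I p)) pb \<and>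
     (\<lambda>p. (\<Sum>i<p. (sig I p i)\<^sup>2) / real p) \<longlonglongrightarrow> (LINT b|pb. b\<^sup>2) \<and>
     (\<exists>W. real_distribution W \<and> integrable W (\<lambda>x. x\<^sup>2) \<and>
        prob_space.expectation W (\<lambda>x. x) = 0 \<and> prob_space.variance W (\<lambda>x. x) = sw\<^sup>2 \<and>
        weak_conv_m (\<lambda>p. empirical (nobs I p) (noise I p)) W) \<and>
     (\<lambda>p. (\<Sum>j<nobs I p. (noise I p j)\<^sup>2) / real (nobs I p)) \<longlonglongrightarrow> sw\<^sup>2 \<and>
     prob_space (pspace I) \<and>
     (\<forall>p\<ge>1.
        prob_space.indep_vars (pspace I) (\<lambda>_. borel) (\<lambda>(j, i). dsg I p j i)
          ({..<nobs I p} \<times> {..<p}) \<and>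
        (\<forall>j<nobs I p. \<forall>i<p.
           distributed (pspace I) lborel (dsg I p j i)
             (normal_density 0 (1 / sqrt (real (nobs I p))))))"

definition response :: "'w lq_instance \<Rightarrow> nat \<Rightarrow> 'w \<Rightarrow> nat \<Rightarrow> real" where
  "response I p \<omega> j = (\<Sum>i<p. dsg I p j i \<omega> * sig I p i) + noise I p j"

definition lq_objective ::
    "'w lq_instance \<Rightarrow> real \<Rightarrow> real \<Rightarrow> nat \<Rightarrow> 'w \<Rightarrow> (nat \<Rightarrow> real) \<Rightarrow> real" where
  "lq_objective I q l p \<omega> b =
     (1/2) * (\<Sum>j<nobs I p. (response I p \<omega> j - (\<Sum>i<p. dsg I p j i \<omega> * b i))\<^sup>2)
     + l * (\<Sum>i<p. \<bar>b i\<bar> powr q)"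

definition lq_estimator ::
    "'w lq_instance \<Rightarrow> real \<Rightarrow> real \<Rightarrow> (nat \<Rightarrow> 'w \<Rightarrow> nat \<Rightarrow> real) \<Rightarrow> bool" where
  "lq_estimator I q l bhat \<longleftrightarrow>
     (\<forall>p\<ge>1. \<forall>\<omega>\<in>space (pspace I). is_arg_min (lq_objective I q l p \<omega>) (\<lambda>_. True) (bhat p \<omega>))"

text \<open>The value must not depend on which minimizers are selected. Minimizers are unique
  if \<open>l > 0\<close> and \<open>q > 1\<close>, but not if \<open>l = 0\<close> and \<open>n(p) < p\<close>: the set of least-squares solutions
  is then unbounded, and no number qualifies as the asymptotic mean square error.\<close>

definition has_AMSE :: "'w lq_instance \<Rightarrow> real \<Rightarrow> real \<Rightarrow> real \<Rightarrow> bool" where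
  "has_AMSE I q l a \<longleftrightarrow>
     (\<forall>bhat. lq_estimator I q l bhat \<longrightarrow>
        (AE \<omega> in pspace I. (\<lambda>p. (\<Sum>i<p. (bhat p \<omega> i - sig I p i)\<^sup>2) / real p) \<longlonglongrightarrow> a))"

definition AMSE :: "'w lq_instance \<Rightarrow> real \<Rightarrow> real \<Rightarrow> real" where
  "AMSE I q l = (THE a. has_AMSE I q l a)"

definition optimal_lambda :: "'w lq_instance \<Rightarrow> real \<Rightarrow> real \<Rightarrow> bool" where
  "optimal_lambda I q l \<longleftrightarrow> is_arg_min (AMSE I q) (\<lambda>l. 0 \<le> l \<and> (\<exists>a. has_AMSE I q l a)) l"

definition eta :: "real \<Rightarrow> real \<Rightarrow> real \<Rightarrow> real" where
  "eta q u c = arg_min (\<lambda>z. (1/2) * (u - z)\<^sup>2 + c * \<bar>z\<bar> powr q) (\<lambda>_. True)"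

text \<open>The joint law of \<open>(B, Z)\<close> with \<open>B \<sim> pb\<close> and \<open>Z \<sim> N(0,1)\<close> independent.\<close>

abbreviation BZ_law :: "real measure \<Rightarrow> (real \<times> real) measure" where
  "BZ_law pb \<equiv> pb \<Otimes>\<^sub>M std_normal_distribution"

definition scalar_mse :: "real measure \<Rightarrow> real \<Rightarrow> real \<Rightarrow> real \<Rightarrow> real" where
  "scalar_mse pb q s c =
     (LINT (b, z)|BZ_law pb. (eta q (b + s * z) (c * s powr (2 - q)) - b)\<^sup>2)"

definition se_solution ::
    "real \<Rightarrow> real measure \<Rightarrow> real \<Rightarrow> real \<Rightarrow> real \<Rightarrow> real \<times> real \<Rightarrow> bool" where
  "se_solution \<delta> pb q sw l = (\<lambda>(s, c).
     0 < s \<and> 0 < c \<and>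
     s\<^sup>2 = sw\<^sup>2 + (1/\<delta>) * scalar_mse pb q s c \<and>
     l = c * s powr (2 - q) *
       (1 - (1/\<delta>) *
         (LINT (b, z)|BZ_law pb. deriv (\<lambda>u. eta q u (c * s powr (2 - q))) (b + s * z))))"

text \<open>The known description of the asymptotic mean square error along \<open>I\<close> for positive
  regularization: the two fixed-point equations have exactly one positive solution \<open>(s, c)\<close>,
  and the almost sure limit exists and equals the corresponding scalar mean square error.\<close>

definition state_evolution :: "real \<Rightarrow> real measure \<Rightarrow> real \<Rightarrow> real \<Rightarrow> 'w lq_instance \<Rightarrow> bool" where
  "state_evolution \<delta> pb q sw I \<longleftrightarrow>
     (\<forall>l>0. (\<exists>!sx. se_solution \<delta> pb q sw l sx) \<and>
        (\<forall>s c. se_solution \<delta> pb q sw l (s, c) \<longrightarrow> has_AMSE I q l (scalar_mse pb q s c)))"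

end

theory Submission
  imports Defs
begin

text \<open>
  The state evolution equations become transparent in the variables \<open>s\<close> (effective noise level)
  and \<open>t = c s\<^sup>2\<^sup>-\<^sup>q\<close> (threshold). Let \<open>M(s,t)\<close> be the mean square error of \<open>\<eta>\<^sub>q(\<cdot>;t)\<close>
  at noise level \<open>s\<close> and \<open>D(s,t)\<close> the mean slope of \<open>\<eta>\<^sub>q(\<cdot>;t)\<close>. A pair solves the equations for
  some penalty level \<open>\<lambda> > 0\<close> iff \<open>M(s,t) = \<delta> (s\<^sup>2 - \<sigma>\<^sub>w\<^sup>2)\<close> and \<open>D(s,t) < \<delta>\<close>, and its error is then
  \<open>\<delta> (s\<^sup>2 - \<sigma>\<^sub>w\<^sup>2)\<close>. The penalty \<open>\<lambda> = 0\<close> does not compete: for \<open>\<delta> < 1\<close> the least-squares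
  solutions form an unbounded set, so no number is the asymptotic error
  (\<open>no_AMSE_without_penalty\<close>). Tuning \<open>\<lambda>\<close> optimally therefore means choosing the smallest
  attainable \<open>s\<close> (\<open>optimal_lambda_least_fixed_point\<close>), and it suffices to show that this smallest
  value \<open>s\<^sub>*(\<sigma>\<^sub>w)\<close> has a positive limit.

  Let \<open>N\<close> be the set of all \<open>s > 0\<close> for which some \<open>t\<close> satisfies \<open>D(s,t) < \<delta>\<close> and
  \<open>M(s,t) < \<delta> s\<^sup>2\<close>. Clearly \<open>s\<^sub>*(\<sigma>\<^sub>w) \<in> N\<close>. Conversely, a point \<open>(s\<^sub>1,t\<^sub>1)\<close> witnessing
  \<open>s\<^sub>1 \<in> N\<close> leads to a solution with \<open>s \<le> s\<^sub>1\<close> for every small \<open>\<sigma>\<^sub>w\<close>: raise \<open>t\<close> from \<open>t\<^sub>1\<close> to a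
  large value, then lower \<open>s\<close> to \<open>\<sigma>\<^sub>w\<close>. Along the first part \<open>D\<close> decreases, along the second it is
  uniformly small, and \<open>\<delta> (s\<^sup>2 - \<sigma>\<^sub>w\<^sup>2) - M\<close> changes sign along the path
  (\<open>fixed_point_below_noise_level\<close>). Thus \<open>s\<^sub>*(\<sigma>\<^sub>w)\<close> tends to the infimum of \<open>N\<close>.

  The infimum is positive because for small noise no threshold reduces the error below \<open>\<delta> s\<^sup>2\<close>
  (\<open>mse_not_below_noise\<close>). The normalized error is \<open>(\<eta> - B)/s = Z - (t/s) \<psi>(\<eta>)\<close>, where \<open>\<psi>\<close> is
  the derivative of \<open>\<bar>\<cdot>\<bar>\<^sup>q\<close>. Let \<open>s \<rightarrow> 0\<close>. If \<open>t/s\<close> converges to \<open>a\<close>, this tends to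
  \<open>Z - a \<psi>(B)\<close>, whose second moment is at least \<open>1\<close>, as \<open>Z\<close> is centred, has variance \<open>1\<close> and is
  independent of \<open>B\<close>. If \<open>t/s \<rightarrow> \<infinity>\<close>, the normalized error explodes on the event \<open>B \<noteq> 0\<close>, which
  has probability \<open>\<epsilon> > 0\<close>. By Fatou's lemma \<open>lim inf M(s,t)/s\<^sup>2 \<ge> 1 > \<delta>\<close> in both cases. It is here
  that \<open>q > 1\<close> enters: \<open>\<psi>\<close> is then continuous, in particular at \<open>0\<close>, so at a zero coordinate the
  limiting error is that of the raw observation.
\<close>

section \<open>The scalar bridge estimator\<close>

context
  fixes q :: real
  assumes q1: "1 < q" and q2: "q \<le> 2"
begin

text \<open>
  The derivative of \<open>\<bar>x\<bar>\<^sup>q\<close>.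
\<close>

definition pen_deriv :: "real \<Rightarrow> real" where
  "pen_deriv x = q * (sgn x * \<bar>x\<bar> powr (q - 1))"

lemma abs_pen_deriv: "\<bar>pen_deriv x\<bar> = q * \<bar>x\<bar> powr (q - 1)"
  using q1 by (auto simp: pen_deriv_def abs_mult abs_sgn_eq)

lemma pen_deriv_nonneg: "0 \<le> x \<Longrightarrow> pen_deriv x = q * x powr (q - 1)"
  using q1 by (cases "x = 0") (auto simp: pen_deriv_def)

lemma pen_deriv_nonpos: "x \<le> 0 \<Longrightarrow> pen_deriv x = - (q * (- x) powr (q - 1))"
  using q1 by (cases "x = 0") (auto simp: pen_deriv_def)

lemma pen_deriv_mono: "x \<le> y \<Longrightarrow> pen_deriv x \<le> pen_deriv y"
proof -
  assume xy: "x \<le> y"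
  consider "0 \<le> x" | "y \<le> 0" | "x < 0" "0 < y" by linarith
  then show ?thesis
  proof cases
    case 1 then show ?thesis using xy q1 by (simp add: pen_deriv_nonneg powr_mono2)
  next
    case 2 then show ?thesis using xy q1 by (simp add: pen_deriv_nonpos powr_mono2)
  next
    case 3
    have "pen_deriv x \<le> 0" using 3 q1 by (simp add: pen_deriv_nonpos)
    also have "0 \<le> pen_deriv y" using 3 q1 by (simp add: pen_deriv_nonneg)
    finally show ?thesis .
  qed
qed

lemma continuous_on_pen_deriv: "continuous_on A pen_deriv"
proof -
  have "pen_deriv = (\<lambda>x. q * (max x 0 powr (q - 1) - max (- x) 0 powr (q - 1)))"
  proof
    fix x show "pen_deriv x = q * (max x 0 powr (q - 1) - max (- x) 0 powr (q - 1))"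
      by (cases "0 \<le> x") (auto simp: pen_deriv_nonneg pen_deriv_nonpos max_def)
  qed
  moreover have "continuous_on A (\<lambda>x. q * (max x 0 powr (q - 1) - max (- x) 0 powr (q - 1)))"
    using q1 by (intro continuous_intros continuous_on_powr') auto
  ultimately show ?thesis by simp
qed

lemma powr_tangent_nonneg:
  assumes "0 \<le> a" "0 \<le> x"
  shows "a powr q + q * a powr (q - 1) * (x - a) \<le> x powr q"
proof (cases "a = 0")
  case True
  then show ?thesis by simp
next
  case False
  show ?thesis
  proof (cases "x = 0")
    case True
    have "a powr q = a powr (q - 1) * a"
      using False assms by (simp add: powr_diff)
    moreover have "0 \<le> (q - 1) * (a powr (q - 1) * a)" using q1 assms by simp
    ultimately show ?thesis using True by (simp add: algebra_simps)
  next
    case xn: False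
    have "x powr q - a powr q \<ge> q * a powr (q - 1) * (x - a)"
    proof (rule convex_on_imp_above_tangent[where A="{0<..}"])
      show "convex_on {0<..} (\<lambda>x::real. x powr q)"
        using powr_convex[of q] q1 by simp
      show "((\<lambda>x. x powr q) has_real_derivative q * a powr (q - 1)) (at a within {0<..})"
        using False assms by (intro has_real_derivative_powr DERIV_subset[OF has_real_derivative_powr]) auto
    qed (use False xn assms in \<open>auto simp: interior_open connected_Ioi\<close>)
    then show ?thesis by simp
  qed
qed

text \<open>
  Both sides of the tangent inequality can be compared through absolute values, because
  \<open>pen_deriv a\<close> has the sign of \<open>a\<close>; this reduces the claim to the convexity of \<open>x\<^sup>q\<close> on
  \<open>x \<ge> 0\<close>.
\<close>

lemma penalty_above_tangent:
  "\<bar>a\<bar> powr q + pen_deriv a * (x - a) \<le> \<bar>x\<bar> powr q"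
proof -
  have "\<bar>a\<bar> powr q + q * \<bar>a\<bar> powr (q - 1) * (\<bar>x\<bar> - \<bar>a\<bar>) \<le> \<bar>x\<bar> powr q"
    by (rule powr_tangent_nonneg) auto
  moreover have "pen_deriv a * (x - a) \<le> q * \<bar>a\<bar> powr (q - 1) * (\<bar>x\<bar> - \<bar>a\<bar>)"
  proof -
    have "pen_deriv a * x \<le> \<bar>pen_deriv a\<bar> * \<bar>x\<bar>"
      by (metis abs_ge_self abs_mult)
    moreover have "pen_deriv a * a = \<bar>pen_deriv a\<bar> * \<bar>a\<bar>"
      unfolding abs_pen_deriv by (simp add: pen_deriv_def abs_sgn mult_ac)
    ultimately show ?thesis unfolding abs_pen_deriv[symmetric] by (simp add: algebra_simps)
  qed
  ultimately show ?thesis by linarith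
qed

text \<open>
  Monotonicity of \<open>pen_deriv\<close> makes \<open>x \<mapsto> x + t pen_deriv x\<close> expansive. The single bound covers the
  continuity of \<open>\<eta>\<^sub>q\<close> in both arguments, and with \<open>t' = 0\<close>, \<open>x' = u'\<close> also the behaviour for
  vanishing thresholds.
\<close>

lemma stationary_point_stable:
  assumes "0 \<le> t" and "x + t * pen_deriv x = u" "x' + t' * pen_deriv x' = u'"
  shows "\<bar>x - x'\<bar> \<le> \<bar>u - u'\<bar> + \<bar>t - t'\<bar> * \<bar>pen_deriv x'\<bar>"
proof -
  have eq: "(x - x') + t * (pen_deriv x - pen_deriv x') = (u - u') - (t - t') * pen_deriv x'"
    using assms(2,3) by (simp add: algebra_simps)
  have "\<bar>x - x'\<bar> \<le> \<bar>(x - x') + t * (pen_deriv x - pen_deriv x')\<bar>"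
  proof (cases "x \<le> x'")
    case True
    then show ?thesis using mult_left_mono[OF pen_deriv_mono[OF True] assms(1)]
      by (simp add: algebra_simps)
  next
    case False
    then show ?thesis using mult_left_mono[OF pen_deriv_mono[of x' x] assms(1)]
      by (simp add: algebra_simps)
  qed
  also have "\<dots> \<le> \<bar>u - u'\<bar> + \<bar>(t - t') * pen_deriv x'\<bar>" unfolding eq by linarith
  finally show ?thesis by (simp add: abs_mult)
qed

lemma stationary_point_exists:
  assumes "0 \<le> t"
  shows "\<exists>x. x + t * pen_deriv x = u"
proof -
  have "\<exists>x\<ge>-\<bar>u\<bar>. x \<le> \<bar>u\<bar> \<and> x + t * pen_deriv x = u"
  proof (rule IVT')
    have "0 \<le> pen_deriv \<bar>u\<bar>" using q1 by (simp add: pen_deriv_nonneg)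
    then show "u \<le> \<bar>u\<bar> + t * pen_deriv \<bar>u\<bar>" using assms
      by (smt (verit) mult_nonneg_nonneg)
    have "pen_deriv (-\<bar>u\<bar>) \<le> 0" using q1 by (simp add: pen_deriv_nonpos)
    then show "- \<bar>u\<bar> + t * pen_deriv (- \<bar>u\<bar>) \<le> u" using assms
      by (smt (verit) mult_nonneg_nonpos)
  qed (auto intro!: continuous_intros continuous_on_pen_deriv)
  then show ?thesis by blast
qed

text \<open>
  The scalar objective is strongly convex: a stationary point \<open>a\<close> beats every other \<open>z\<close> by at
  least \<open>(z - a)\<^sup>2/2\<close>. Hence the minimizer picked by \<open>eta\<close> is that point, and the first-order
  condition characterizes it.
\<close>

lemma eta_stationary:
  assumes t: "0 \<le> t"
  shows "eta q u t + t * pen_deriv (eta q u t) = u"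
proof -
  obtain a where a: "a + t * pen_deriv a = u" using stationary_point_exists[OF t] by blast
  let ?f = "\<lambda>z. (1/2) * (u - z)\<^sup>2 + t * \<bar>z\<bar> powr q"
  have gap: "?f a + (1/2) * (z - a)\<^sup>2 \<le> ?f z" for z
  proof -
    have "t * (\<bar>a\<bar> powr q + pen_deriv a * (z - a)) \<le> t * \<bar>z\<bar> powr q"
      by (rule mult_left_mono[OF penalty_above_tangent t])
    moreover have "t * pen_deriv a = u - a" using a by simp
    ultimately have "t * \<bar>a\<bar> powr q + (u - a) * (z - a) \<le> t * \<bar>z\<bar> powr q"
      by (metis distrib_left mult.assoc)
    then show ?thesis by (simp add: power2_eq_square algebra_simps)
  qed
  have "is_arg_min ?f (\<lambda>_. True) a"
    unfolding is_arg_min_linorder using gap by (meson TrueI add_increasing2 dual_order.trans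
      le_add_same_cancel1 mult_nonneg_nonneg zero_le_divide_1_iff zero_le_numeral zero_le_power2)
  then have "is_arg_min ?f (\<lambda>_. True) (eta q u t)"
    unfolding eta_def arg_min_def by (rule someI)
  then have "?f (eta q u t) \<le> ?f a" by (auto simp: is_arg_min_linorder)
  with gap[of "eta q u t"] have "(eta q u t - a)\<^sup>2 \<le> 0" by linarith
  then have "eta q u t = a" by simp
  then show ?thesis using a by simp
qed

lemma abs_eta_stationary:
  assumes "0 \<le> t"
  shows "\<bar>eta q u t\<bar> + t * q * \<bar>eta q u t\<bar> powr (q - 1) = \<bar>u\<bar>"
proof -
  let ?x = "eta q u t"
  have "u = ?x + t * pen_deriv ?x" using eta_stationary[OF assms] by simp
  also have "\<dots> = sgn ?x * (\<bar>?x\<bar> + t * q * \<bar>?x\<bar> powr (q - 1))"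
    unfolding pen_deriv_def distrib_left sgn_mult_abs by (simp add: mult_ac)
  finally have "u = sgn ?x * (\<bar>?x\<bar> + t * q * \<bar>?x\<bar> powr (q - 1))" .
  then have "\<bar>u\<bar> = \<bar>sgn ?x\<bar> * \<bar>\<bar>?x\<bar> + t * q * \<bar>?x\<bar> powr (q - 1)\<bar>"
    by (metis abs_mult)
  moreover have "0 \<le> \<bar>?x\<bar> + t * q * \<bar>?x\<bar> powr (q - 1)" using assms q1 by simp
  ultimately show ?thesis by (auto simp: abs_sgn_eq)
qed

lemma abs_eta_le: "0 \<le> t \<Longrightarrow> \<bar>eta q u t\<bar> \<le> \<bar>u\<bar>"
  using abs_eta_stationary[of t u] q1 by (metis add_increasing2 le_add_same_cancel1 less_eq_real_def
      mult_nonneg_nonneg order_refl powr_ge_zero order.strict_trans zero_less_one)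

lemma abs_eta_antimono:
  assumes "0 \<le> t" "t \<le> t'"
  shows "\<bar>eta q u t'\<bar> \<le> \<bar>eta q u t\<bar>"
proof (rule ccontr)
  assume less: "\<not> \<bar>eta q u t'\<bar> \<le> \<bar>eta q u t\<bar>"
  then have "t * q * \<bar>eta q u t\<bar> powr (q - 1) \<le> t' * q * \<bar>eta q u t'\<bar> powr (q - 1)"
    using assms q1 by (intro mult_mono powr_mono2) auto
  then show False
    using less abs_eta_stationary[of t u] abs_eta_stationary[of t' u] assms by linarith
qed

lemma eta_0 [simp]: "0 \<le> t \<Longrightarrow> eta q 0 t = 0"
  using abs_eta_le[of t 0] by simp

lemma eta_eq_0_iff: "0 \<le> t \<Longrightarrow> eta q u t = 0 \<longleftrightarrow> u = 0"
  using abs_eta_stationary[of t u] eta_0[of t] by (metis abs_0 abs_eq_0 add_0 mult_zero_right powr_0)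

lemma eta_stable:
  assumes "0 \<le> t" "0 \<le> t'"
  shows "\<bar>eta q u t - eta q u' t'\<bar> \<le> \<bar>u - u'\<bar> + \<bar>t - t'\<bar> * \<bar>pen_deriv (eta q u' t')\<bar>"
  by (rule stationary_point_stable[OF assms(1) eta_stationary eta_stationary]) (use assms in auto)

lemma tendsto_eta:
  assumes "(U \<longlongrightarrow> u) F" "(T \<longlongrightarrow> t) F" "\<And>n. 0 \<le> T n" "0 \<le> t"
  shows "((\<lambda>n. eta q (U n) (T n)) \<longlongrightarrow> eta q u t) F"
proof (rule LIM_zero_cancel, rule Lim_null_comparison)
  show "((\<lambda>n. \<bar>U n - u\<bar> + \<bar>T n - t\<bar> * \<bar>pen_deriv (eta q u t)\<bar>) \<longlongrightarrow> 0) F"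
    using assms(1,2) by (auto intro!: tendsto_eq_intros)
  show "\<forall>\<^sub>F n in F. norm (eta q (U n) (T n) - eta q u t)
      \<le> \<bar>U n - u\<bar> + \<bar>T n - t\<bar> * \<bar>pen_deriv (eta q u t)\<bar>"
    using eta_stable assms by simp
qed

lemma continuous_on_eta: "0 \<le> t \<Longrightarrow> continuous_on A (\<lambda>u. eta q u t)"
  unfolding continuous_on_def by (intro ballI tendsto_eta) auto

lemma borel_measurable_eta [measurable]:
  "0 \<le> t \<Longrightarrow> (\<lambda>u. eta q u t) \<in> borel_measurable borel"
  by (intro borel_measurable_continuous_onI continuous_on_eta)

text \<open>
  Up to the factor \<open>1/(q (q - 1))\<close> the reciprocal of the second derivative of \<open>\<bar>x\<bar>\<^sup>q\<close>. In contrast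
  to the second derivative itself it is finite and continuous at \<open>0\<close>. The case distinction is
  needed because \<open>0 powr 0 = 0\<close>.
\<close>

definition inv_curv :: "real \<Rightarrow> real" where
  "inv_curv x = (if q = 2 then 1 else \<bar>x\<bar> powr (2 - q))"

text \<open>
  The derivative of \<open>u \<mapsto> \<eta>\<^sub>q(u;t)\<close>, obtained by differentiating the first-order condition.
\<close>

definition eta_slope :: "real \<Rightarrow> real \<Rightarrow> real" where
  "eta_slope t u = inv_curv (eta q u t) / (inv_curv (eta q u t) + t * q * (q - 1))"

lemma inv_curv_nonneg: "0 \<le> inv_curv x"
  by (simp add: inv_curv_def)

lemma inv_curv_mono: "\<bar>x\<bar> \<le> \<bar>y\<bar> \<Longrightarrow> inv_curv x \<le> inv_curv y"
  using q2 by (simp add: inv_curv_def powr_mono2)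

lemma inv_curv_le: "inv_curv x \<le> 1 + \<bar>x\<bar>"
proof (cases "\<bar>x\<bar> \<le> 1")
  case True
  then have "\<bar>x\<bar> powr (2 - q) \<le> 1" using q2 by (intro powr_le1) auto
  then show ?thesis by (simp add: inv_curv_def add_increasing2)
next
  case False
  then have "\<bar>x\<bar> powr (2 - q) \<le> \<bar>x\<bar> powr 1" using q1 by (intro powr_mono) auto
  then show ?thesis using False by (simp add: inv_curv_def)
qed

lemma pen_deriv_has_derivative:
  assumes "x \<noteq> 0"
  shows "(pen_deriv has_real_derivative q * (q - 1) * \<bar>x\<bar> powr (q - 2)) (at x)"
proof (cases "0 < x")
  case True
  have "((\<lambda>x. q * x powr (q - 1)) has_real_derivative q * ((q - 1) * x powr (q - 1 - 1))) (at x)"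
    using True by (intro DERIV_cmult has_real_derivative_powr)
  then have "((\<lambda>x. q * x powr (q - 1)) has_real_derivative q * (q - 1) * \<bar>x\<bar> powr (q - 2)) (at x)"
    using True by (simp add: mult_ac)
  moreover have "\<forall>\<^sub>F y in nhds x. pen_deriv y = q * y powr (q - 1)"
    using eventually_nhds_in_open[of "{0<..}" x] True
    by (auto elim!: eventually_mono simp: pen_deriv_nonneg)
  ultimately show ?thesis by (subst DERIV_cong_ev[OF refl _ refl])
next
  case False
  then have x: "x < 0" using assms by simp
  have "((\<lambda>x. - (q * (- x) powr (q - 1))) has_real_derivative
      - (q * (((q - 1) * (- x) powr (q - 1 - 1)) * (- 1)))) (at x)"
    using x by (intro DERIV_minus DERIV_cmult DERIV_chain2[OF has_real_derivative_powr]) (auto intro!: derivative_eq_intros)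
  then have "((\<lambda>x. - (q * (- x) powr (q - 1))) has_real_derivative
      q * (q - 1) * \<bar>x\<bar> powr (q - 2)) (at x)"
    using x by (simp add: mult_ac)
  moreover have "\<forall>\<^sub>F y in nhds x. pen_deriv y = - (q * (- y) powr (q - 1))"
    using eventually_nhds_in_open[of "{..<0}" x] x
    by (auto elim!: eventually_mono simp: pen_deriv_nonpos)
  ultimately show ?thesis by (subst DERIV_cong_ev[OF refl _ refl])
qed

lemma has_derivative_eta_nonzero:
  assumes t: "0 \<le> t" and u: "u \<noteq> 0"
  shows "((\<lambda>u. eta q u t) has_real_derivative eta_slope t u) (at u)"
proof -
  let ?x = "eta q u t"
  have x: "?x \<noteq> 0" using u t by (simp add: eta_eq_0_iff)
  have k: "inv_curv ?x > 0" using x by (simp add: inv_curv_def)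
  have ik: "\<bar>?x\<bar> powr (q - 2) = inverse (inv_curv ?x)"
    using x powr_minus[of "\<bar>?x\<bar>" "2 - q"] by (auto simp: inv_curv_def)
  let ?D = "1 + t * (q * (q - 1) * \<bar>?x\<bar> powr (q - 2))"
  have Dpos: "?D > 0" using t q1 by (smt (verit) mult_nonneg_nonneg powr_ge_zero)
  have "((\<lambda>u. eta q u t) has_real_derivative inverse ?D) (at u)"
  proof (rule DERIV_inverse_function[where f = "\<lambda>x. x + t * pen_deriv x" and a="u-1" and b="u+1"])
    show "((\<lambda>x. x + t * pen_deriv x) has_real_derivative ?D) (at ?x)"
      by (intro DERIV_add DERIV_ident DERIV_cmult pen_deriv_has_derivative x)
    show "isCont (\<lambda>u. eta q u t) u"
      using continuous_on_eta[OF t, of UNIV] by (simp add: continuous_on_eq_continuous_at)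
  qed (use Dpos eta_stationary[OF t] in auto)
  moreover have "inverse ?D = eta_slope t u"
    unfolding eta_slope_def ik using k t q1 by (simp add: field_simps)
  ultimately show ?thesis by simp
qed

text \<open>
  At \<open>0\<close> the implicit function argument breaks down, since the second derivative of the penalty is
  infinite for \<open>q < 2\<close>. Instead the first-order condition gives the difference quotient as a
  function of \<open>\<eta>\<^sub>q(u;t)\<close> that extends continuously to \<open>0\<close>.
\<close>

lemma has_derivative_eta_zero:
  assumes t: "0 < t"
  shows "((\<lambda>u. eta q u t) has_real_derivative eta_slope t 0) (at 0)"
proof -
  have quot: "eta q u t / u = inv_curv (eta q u t) / (inv_curv (eta q u t) + t * q)" if "u \<noteq> 0" for u
  proof -
    let ?x = "eta q u t"
    have x: "?x \<noteq> 0" using that t by (simp add: eta_eq_0_iff)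
    have k: "inv_curv ?x > 0" using x by (simp add: inv_curv_def)
    have "inv_curv ?x * \<bar>?x\<bar> powr (q - 1) = \<bar>?x\<bar>"
      using x by (auto simp: inv_curv_def powr_add[symmetric])
    then have "inv_curv ?x * pen_deriv ?x = q * ?x"
      unfolding pen_deriv_def by (metis (no_types, opaque_lifting) mult.assoc mult.commute sgn_mult_abs)
    then have "inv_curv ?x * (?x + t * pen_deriv ?x) = ?x * (inv_curv ?x + t * q)"
      by (simp add: algebra_simps)
    then have "inv_curv ?x * u = ?x * (inv_curv ?x + t * q)"
      using eta_stationary[of t u] t by simp
    moreover have "inv_curv ?x + t * q > 0" using k t q1 by (simp add: add_pos_pos)
    ultimately show ?thesis using that by (simp add: field_simps)
  qed
  have slope0: "eta_slope t 0 = inv_curv 0 / (inv_curv 0 + t * q)"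
    using t q1 q2 by (auto simp: eta_slope_def inv_curv_def)
  have "((\<lambda>u. eta q u t) \<longlongrightarrow> 0) (at 0)"
    using tendsto_eta[of "\<lambda>u. u" 0 "at 0" "\<lambda>_. t" t] t by simp
  then have "((\<lambda>u. inv_curv (eta q u t)) \<longlongrightarrow> inv_curv 0) (at 0)"
    using q2 unfolding inv_curv_def
    by (cases "q = 2") (auto intro!: tendsto_eq_intros)
  then have "((\<lambda>u. inv_curv (eta q u t) / (inv_curv (eta q u t) + t * q))
      \<longlongrightarrow> eta_slope t 0) (at 0)"
    unfolding slope0 using t q1 inv_curv_nonneg[of 0]
    by (intro tendsto_intros) (auto simp: add_nonneg_eq_0_iff)
  then have "((\<lambda>u. eta q u t / u) \<longlongrightarrow> eta_slope t 0) (at 0)"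
    by (rule Lim_transform_eventually) (use quot in \<open>auto simp: eventually_at_filter\<close>)
  then show ?thesis
    using t by (simp add: has_field_derivative_iff)
qed

lemma deriv_eta: "0 < t \<Longrightarrow> deriv (\<lambda>u. eta q u t) u = eta_slope t u"
  by (cases "u = 0") (auto intro!: DERIV_imp_deriv has_derivative_eta_zero has_derivative_eta_nonzero)

lemma eta_slope_bounds:
  assumes "0 < t"
  shows "0 \<le> eta_slope t u" "eta_slope t u \<le> 1" "eta_slope t u \<le> (1 + \<bar>u\<bar>) / (t * q * (q - 1))"
proof -
  have c: "0 < t * q * (q - 1)" using assms q1 by simp
  have k: "0 \<le> inv_curv (eta q u t)" by (rule inv_curv_nonneg)
  show "0 \<le> eta_slope t u" "eta_slope t u \<le> 1"
    unfolding eta_slope_def using c k by (auto simp: divide_le_eq_1)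
  have "inv_curv (eta q u t) \<le> 1 + \<bar>u\<bar>"
    using inv_curv_le[of "eta q u t"] abs_eta_le[of t u] assms by linarith
  then show "eta_slope t u \<le> (1 + \<bar>u\<bar>) / (t * q * (q - 1))"
    unfolding eta_slope_def using c k by (intro frac_le) auto
qed

text \<open>
  Raising the threshold lowers \<open>\<bar>\<eta>\<^sub>q\<bar>\<close>, hence \<open>inv_curv\<close>, and raises the second summand of the
  denominator; both effects lower the slope.
\<close>

lemma eta_slope_antimono:
  assumes "0 < t" "t \<le> t'"
  shows "eta_slope t' u \<le> eta_slope t u"
proof -
  let ?k = "inv_curv (eta q u t)" and ?k' = "inv_curv (eta q u t')"
  have k: "0 \<le> ?k'" "?k' \<le> ?k"
    using inv_curv_nonneg inv_curv_mono abs_eta_antimono[of t t' u] assms by auto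
  have c: "0 < t * q * (q - 1)" "t * q * (q - 1) \<le> t' * q * (q - 1)"
    using assms q1 by (auto simp: mult_right_mono)
  have "?k' * (t * q * (q - 1)) \<le> ?k * (t' * q * (q - 1))"
    by (rule mult_mono) (use k c in auto)
  moreover have "x / (x + a) \<le> y / (y + b)"
    if "x * b \<le> y * a" "0 < a" "0 < b" "0 \<le> x" "0 \<le> y" for x y a b :: real
    using that by (simp add: divide_simps algebra_simps add_pos_nonneg)
  ultimately show ?thesis
    unfolding eta_slope_def using k c by auto
qed

lemma borel_measurable_eta_slope [measurable]:
  "0 \<le> t \<Longrightarrow> eta_slope t \<in> borel_measurable borel"
  unfolding eta_slope_def inv_curv_def by measurable

end

section \<open>The Gaussian scalar channel\<close>

lemma integrable_pair_fst:
  assumes "prob_space M" "prob_space N" "integrable M (f :: _ \<Rightarrow> real)"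
  shows "integrable (M \<Otimes>\<^sub>M N) (\<lambda>x. f (fst x))"
proof -
  have "distr (M \<Otimes>\<^sub>M N) M fst = M"
    using prob_space.distr_pair_fst[OF assms(2)] .
  then have "integrable (distr (M \<Otimes>\<^sub>M N) M fst) f" using assms(3) by simp
  then show ?thesis by (subst (asm) integrable_distr_eq) (use assms(3) in auto)
qed

lemma integrable_pair_snd:
  assumes "prob_space M" "prob_space N" "integrable N (f :: _ \<Rightarrow> real)"
  shows "integrable (M \<Otimes>\<^sub>M N) (\<lambda>x. f (snd x))"
proof -
  interpret M: prob_space M by fact
  interpret N: prob_space N by fact
  interpret P: pair_prob_space M N ..
  have "integrable (distr (N \<Otimes>\<^sub>M M) (M \<Otimes>\<^sub>M N) (\<lambda>(x, y). (y, x))) (\<lambda>x. f (snd x))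
      \<longleftrightarrow> integrable (N \<Otimes>\<^sub>M M) (\<lambda>x. f (fst x))"
    using assms(3) by (subst integrable_distr_eq) (auto simp: case_prod_beta)
  then show ?thesis
    using integrable_pair_fst[OF assms(2,1,3)] P.distr_pair_swap by simp
qed

lemma nn_integral_std_normal_shift:
  "1 \<le> (\<integral>\<^sup>+ z. ennreal ((z - c)\<^sup>2) \<partial>std_normal_distribution)"
proof -
  interpret N: real_distribution std_normal_distribution by (rule real_dist_normal_dist)
  have i: "integrable std_normal_distribution (\<lambda>z. z\<^sup>2)" "integrable std_normal_distribution (\<lambda>z. z)"
    using integrable_std_normal_distribution_moment[of 2] integrable_std_normal_distribution_moment[of 1]
    by auto
  have e: "(LINT z|std_normal_distribution. z\<^sup>2) = 1"
    using std_normal_distribution_even_moments(1)[of 1] by (simp add: fact_numeral)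
  have o: "(LINT z|std_normal_distribution. z) = 0"
    using integral_std_normal_distribution_moment_odd[of 1] by simp
  have eq: "(\<lambda>z. (z - c)\<^sup>2) = (\<lambda>z. z\<^sup>2 - 2 * c * z + c\<^sup>2)"
    by (auto simp: power2_diff)
  have int: "integrable std_normal_distribution (\<lambda>z. (z - c)\<^sup>2)"
    unfolding eq using i by auto
  have "(LINT z|std_normal_distribution. (z - c)\<^sup>2) = 1 + c\<^sup>2"
    unfolding eq using i e o N.prob_space by simp
  then show ?thesis
    by (subst nn_integral_eq_integral[OF int]) (auto simp: ennreal_1[symmetric] ennreal_leI simp del: ennreal_1)
qed

text \<open>
  The observation \<open>B + s Z\<close> with \<open>B \<sim> pb\<close> and standard normal \<open>Z\<close>, denoised by \<open>\<eta>\<^sub>q\<close>.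
\<close>

locale scalar_channel = pb: real_distribution pb for pb :: "real measure" +
  fixes q :: real
  assumes q1: "1 < q" and q2: "q \<le> 2"
    and second_moment: "integrable pb (\<lambda>b. b\<^sup>2)"
begin

sublocale normal: real_distribution std_normal_distribution
  by (rule real_dist_normal_dist)

sublocale BZ: pair_prob_space pb std_normal_distribution ..

text \<open>
  The second argument is the threshold \<open>t = c s\<^sup>2\<^sup>-\<^sup>q\<close> itself rather than \<open>c\<close>: for a fixed
  threshold the estimator does not change with \<open>s\<close>, which simplifies continuity and monotonicity.
\<close>

definition mse :: "real \<Rightarrow> real \<Rightarrow> real" where
  "mse s t = (LINT (b, z)|BZ_law pb. (eta q (b + s * z) t - b)\<^sup>2)"

definition mean_slope :: "real \<Rightarrow> real \<Rightarrow> real" where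
  "mean_slope s t = (LINT (b, z)|BZ_law pb. deriv (\<lambda>u. eta q u t) (b + s * z))"

lemmas eta_meas [measurable] = borel_measurable_eta[OF q1 q2]

lemma integrable_envelope:
  "integrable (BZ_law pb) (\<lambda>x. 8 * (fst x)\<^sup>2 + 2 * S\<^sup>2 * (snd x)\<^sup>2)"
proof -
  have "integrable (BZ_law pb) (\<lambda>x. (fst x)\<^sup>2)"
    by (rule integrable_pair_fst[where f="\<lambda>x. x\<^sup>2"]) (unfold_locales, rule second_moment)
  moreover have "integrable (BZ_law pb) (\<lambda>x. (snd x)\<^sup>2)"
    by (rule integrable_pair_snd[where f="\<lambda>x. x\<^sup>2"])
      (unfold_locales, rule integrable_std_normal_distribution_moment)
  ultimately show ?thesis by auto
qed

text \<open>
  A square-integrable envelope, uniform over all thresholds and over bounded noise levels, since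
  \<open>\<eta>\<^sub>q\<close> never exceeds its argument in absolute value.
\<close>

lemma sq_error_le:
  assumes "0 \<le> t" "\<bar>s\<bar> \<le> S"
  shows "(eta q (b + s * z) t - b)\<^sup>2 \<le> 8 * b\<^sup>2 + 2 * S\<^sup>2 * z\<^sup>2"
proof -
  have "\<bar>eta q (b + s * z) t - b\<bar> \<le> \<bar>b + s * z\<bar> + \<bar>b\<bar>"
    using abs_eta_le[OF q1 q2 assms(1), of "b + s * z"] by linarith
  also have "\<dots> \<le> 2 * \<bar>b\<bar> + \<bar>s\<bar> * \<bar>z\<bar>"
    using abs_triangle_ineq[of b "s * z"] by (simp add: abs_mult)
  also have "\<dots> \<le> 2 * \<bar>b\<bar> + S * \<bar>z\<bar>"
    using assms(2) by (simp add: mult_right_mono)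
  finally have "(eta q (b + s * z) t - b)\<^sup>2 \<le> (2 * \<bar>b\<bar> + S * \<bar>z\<bar>)\<^sup>2"
    by (meson abs_ge_zero abs_le_square_iff order_trans abs_ge_self)
  also have "\<dots> \<le> 2 * (2 * \<bar>b\<bar>)\<^sup>2 + 2 * (S * \<bar>z\<bar>)\<^sup>2"
    using zero_le_power2[of "2 * \<bar>b\<bar> - S * \<bar>z\<bar>"] unfolding power2_sum power2_diff by linarith
  finally show ?thesis by (simp add: power_mult_distrib)
qed

lemma integrable_sq_error:
  assumes "0 \<le> t"
  shows "integrable (BZ_law pb) (\<lambda>(b, z). (eta q (b + s * z) t - b)\<^sup>2)"
  by (rule Bochner_Integration.integrable_bound[OF integrable_envelope[of "\<bar>s\<bar>"]])
    (use assms sq_error_le[OF assms, of s "\<bar>s\<bar>"] in \<open>auto simp: case_prod_beta intro!: AE_I2\<close>)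

lemma measurable_sq_error [measurable]:
  assumes "0 \<le> t"
  shows "(\<lambda>(b, z). ennreal (((eta q (b + s * z) t - b) / r)\<^sup>2)) \<in> borel_measurable (BZ_law pb)"
  using assms by measurable

lemma mse_nonneg: "0 \<le> mse s t"
  unfolding mse_def by (intro integral_nonneg_AE AE_I2) auto

lemma nn_integral_sq_error:
  assumes "0 \<le> t" "0 < s"
  shows "(\<integral>\<^sup>+ (b, z). ennreal (((eta q (b + s * z) t - b) / s)\<^sup>2) \<partial>BZ_law pb) = ennreal (mse s t / s\<^sup>2)"
proof -
  have "integrable (BZ_law pb) (\<lambda>(b, z). ((eta q (b + s * z) t - b) / s)\<^sup>2)"
    using integrable_divide[OF integrable_sq_error[OF assms(1), of s], of "s\<^sup>2"]
    by (simp add: case_prod_unfold power_divide)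
  moreover have "(LINT (b, z)|BZ_law pb. ((eta q (b + s * z) t - b) / s)\<^sup>2) = mse s t / s\<^sup>2"
    unfolding mse_def by (simp add: case_prod_unfold power_divide)
  ultimately show ?thesis
    unfolding case_prod_unfold by (subst nn_integral_eq_integral) auto
qed

lemma tendsto_mse:
  assumes "S \<longlonglongrightarrow> s" "T \<longlonglongrightarrow> t" "\<And>n. 0 \<le> T n" "0 \<le> t"
  shows "(\<lambda>n. mse (S n) (T n)) \<longlonglongrightarrow> mse s t"
proof -
  obtain K where K: "\<And>n. \<bar>S n\<bar> \<le> K"
    using convergent_imp_Bseq[OF convergentI[OF assms(1)]] unfolding Bseq_def real_norm_def by blast
  show ?thesis unfolding mse_def
  proof (rule integral_dominated_convergence[OF _ _ integrable_envelope[of K]])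
    show "AE x in BZ_law pb. (\<lambda>n. case x of (b, z) \<Rightarrow> (eta q (b + S n * z) (T n) - b)\<^sup>2)
        \<longlonglongrightarrow> (case x of (b, z) \<Rightarrow> (eta q (b + s * z) t - b)\<^sup>2)"
      by (rule AE_I2) (auto intro!: tendsto_intros tendsto_eta[OF q1 q2] assms)
    show "AE x in BZ_law pb. norm (case x of (b, z) \<Rightarrow> (eta q (b + S n * z) (T n) - b)\<^sup>2)
        \<le> 8 * (fst x)\<^sup>2 + 2 * K\<^sup>2 * (snd x)\<^sup>2" for n
      by (rule AE_I2) (auto intro!: sq_error_le assms K)
  qed (use assms in auto)
qed

lemma continuous_on_mse:
  assumes "continuous_on A f" "continuous_on A g" "\<And>x. x \<in> A \<Longrightarrow> 0 \<le> g x"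
  shows "continuous_on A (\<lambda>x::real. mse (f x) (g x))"
  unfolding continuous_on_sequentially
proof (intro allI ballI impI)
  fix x a assume x: "a \<in> A" "(\<forall>n. x n \<in> A) \<and> x \<longlonglongrightarrow> a"
  then have "(f \<circ> x) \<longlonglongrightarrow> f a" "(g \<circ> x) \<longlonglongrightarrow> g a"
    using assms(1,2) unfolding continuous_on_sequentially by blast+
  then show "((\<lambda>x. mse (f x) (g x)) \<circ> x) \<longlonglongrightarrow> mse (f a) (g a)"
    using tendsto_mse[of "f \<circ> x" "f a" "g \<circ> x" "g a"] x assms(3) by (simp add: o_def)
qed

lemma integrable_eta_slope:
  assumes "0 < t"
  shows "integrable (BZ_law pb) (\<lambda>(b, z). eta_slope q t (b + s * z))"
proof -
  have [measurable]: "eta_slope q t \<in> borel_measurable borel"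
    using borel_measurable_eta_slope[OF q1 q2] assms by simp
  show ?thesis
    by (rule BZ.P.integrable_const_bound[where B = 1])
      (use eta_slope_bounds[OF q1 q2 assms] in \<open>auto intro!: AE_I2\<close>)
qed

lemma mean_slope_eq:
  "0 < t \<Longrightarrow> mean_slope s t = (LINT (b, z)|BZ_law pb. eta_slope q t (b + s * z))"
  unfolding mean_slope_def by (simp add: deriv_eta[OF q1 q2])

lemma mean_slope_antimono:
  assumes "0 < t" "t \<le> t'"
  shows "mean_slope s t' \<le> mean_slope s t"
  using assms unfolding mean_slope_eq[OF assms(1)] mean_slope_eq[OF less_le_trans[OF assms]]
  by (intro integral_mono integrable_eta_slope)
     (auto intro!: eta_slope_antimono[OF q1 q2])

text \<open>
  Uniformly over bounded noise levels the mean slope is at most of order \<open>1/t\<close>: the slope at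
  \<open>u\<close> is at most \<open>(1 + \<bar>u\<bar>)/(t q (q - 1))\<close>, and \<open>B + s Z\<close> has a bounded first absolute moment.
\<close>

lemma mean_slope_small:
  assumes "0 < d"
  shows "\<exists>C. \<forall>t\<ge>C. \<forall>s. 0 < t \<longrightarrow> 0 \<le> s \<longrightarrow> s \<le> S \<longrightarrow> mean_slope s t < d"
proof -
  define E where "E = (LINT x|BZ_law pb. 1 + \<bar>fst x\<bar> + S * \<bar>snd x\<bar>)"
  have "integrable pb (\<lambda>b. b)"
    using pb.square_integrable_imp_integrable[OF _ second_moment] by simp
  then have "integrable (BZ_law pb) (\<lambda>x. \<bar>fst x\<bar>)"
    by (intro integrable_pair_fst[where f = "\<lambda>x. \<bar>x\<bar>"]) (unfold_locales, simp)
  moreover have "integrable (BZ_law pb) (\<lambda>x. \<bar>snd x\<bar>)"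
    using integrable_std_normal_distribution_moment[of 1]
    by (intro integrable_pair_snd[where f = "\<lambda>x. \<bar>x\<bar>"]) (unfold_locales, simp)
  ultimately have int: "integrable (BZ_law pb) (\<lambda>x. 1 + \<bar>fst x\<bar> + S * \<bar>snd x\<bar>)"
    by auto
  have bound: "mean_slope s t \<le> E / (t * q * (q - 1))" if "0 < t" "0 \<le> s" "s \<le> S" for s t
  proof -
    have "mean_slope s t \<le> (LINT x|BZ_law pb. (1 + \<bar>fst x\<bar> + S * \<bar>snd x\<bar>) / (t * q * (q - 1)))"
      unfolding mean_slope_eq[OF that(1)]
    proof (intro integral_mono integrable_eta_slope integrable_divide int)
      fix x
      have "eta_slope q t (fst x + s * snd x) \<le> (1 + \<bar>fst x + s * snd x\<bar>) / (t * q * (q - 1))"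
        by (rule eta_slope_bounds[OF q1 q2 that(1)])
      also have "\<dots> \<le> (1 + \<bar>fst x\<bar> + S * \<bar>snd x\<bar>) / (t * q * (q - 1))"
      proof (rule divide_right_mono)
        have "\<bar>fst x + s * snd x\<bar> \<le> \<bar>fst x\<bar> + s * \<bar>snd x\<bar>"
          using abs_triangle_ineq[of "fst x" "s * snd x"] that by (simp add: abs_mult)
        also have "\<dots> \<le> \<bar>fst x\<bar> + S * \<bar>snd x\<bar>" using that by (simp add: mult_right_mono)
        finally show "1 + \<bar>fst x + s * snd x\<bar> \<le> 1 + \<bar>fst x\<bar> + S * \<bar>snd x\<bar>" by simp
      qed (use that q1 in auto)
      finally show "(case x of (b, z) \<Rightarrow> eta_slope q t (b + s * z))
          \<le> (1 + \<bar>fst x\<bar> + S * \<bar>snd x\<bar>) / (t * q * (q - 1))" by (simp add: case_prod_beta)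
    qed (use that in auto)
    then show ?thesis unfolding E_def by simp
  qed
  show ?thesis
  proof (intro exI allI impI)
    fix t s assume t: "(\<bar>E\<bar> + 1) / (d * q * (q - 1)) \<le> t" "0 < t" "0 \<le> s" "s \<le> S"
    have p: "0 < q * (q - 1)" using q1 by simp
    have "E < \<bar>E\<bar> + 1" by simp
    also have "\<bar>E\<bar> + 1 \<le> d * (t * q * (q - 1))"
      using t(1) p assms by (simp add: field_simps)
    finally have "E / (t * q * (q - 1)) < d"
      using t p assms by (simp add: pos_divide_less_eq mult.assoc)
    then show "mean_slope s t < d" using bound[OF t(2-4)] by linarith
  qed
qed

text \<open>
  As the threshold \<open>t = (t/s) s\<close> also tends to \<open>0\<close>, the estimate converges to \<open>b\<close>, and by the
  first-order condition the normalized error is \<open>z - (t/s) pen_deriv (\<eta>) \<rightarrow> z - a pen_deriv b\<close>.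
  Fatou's lemma then applies, and the second moment of the limit is at least \<open>1\<close> for each \<open>b\<close>.
\<close>

lemma ratio_bounded_case:
  assumes "S \<longlonglongrightarrow> 0" "\<And>n. 0 < S n" "\<And>n. 0 < T n" "(\<lambda>n. T n / S n) \<longlonglongrightarrow> a"
  shows "1 \<le> liminf (\<lambda>n. ennreal (mse (S n) (T n) / (S n)\<^sup>2))"
proof -
  have T0: "T \<longlonglongrightarrow> 0"
    using tendsto_mult[OF assms(4,1)] assms(2) by (simp add: less_imp_neq[symmetric])
  have lim: "(\<lambda>n. ((eta q (b + S n * z) (T n) - b) / S n)\<^sup>2) \<longlonglongrightarrow> (z - a * pen_deriv q b)\<^sup>2" for b z
  proof -
    have "(\<lambda>n. eta q (b + S n * z) (T n)) \<longlonglongrightarrow> b"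
    proof (rule LIM_zero_cancel, rule Lim_null_comparison)
      show "\<forall>\<^sub>F n in sequentially. norm (eta q (b + S n * z) (T n) - b)
          \<le> \<bar>b + S n * z - b\<bar> + \<bar>T n - 0\<bar> * \<bar>pen_deriv q b\<bar>"
        unfolding real_norm_def
        by (intro always_eventually allI stationary_point_stable[OF q1 q2 _ eta_stationary[OF q1 q2]])
           (use assms(3) in \<open>auto intro: less_imp_le\<close>)
      show "(\<lambda>n. \<bar>b + S n * z - b\<bar> + \<bar>T n - 0\<bar> * \<bar>pen_deriv q b\<bar>) \<longlonglongrightarrow> 0"
        using T0 assms(1) by (auto intro!: tendsto_eq_intros)
    qed
    then have "(\<lambda>n. pen_deriv q (eta q (b + S n * z) (T n))) \<longlonglongrightarrow> pen_deriv q b"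
      using continuous_on_pen_deriv[OF q1 q2, of UNIV]
      by (intro isCont_tendsto_compose[of b "pen_deriv q"]) (auto simp: continuous_on_eq_continuous_at)
    then have "(\<lambda>n. (z - T n / S n * pen_deriv q (eta q (b + S n * z) (T n)))\<^sup>2)
        \<longlonglongrightarrow> (z - a * pen_deriv q b)\<^sup>2"
      by (intro tendsto_intros assms)
    moreover have "z - T n / S n * pen_deriv q (eta q (b + S n * z) (T n))
        = (eta q (b + S n * z) (T n) - b) / S n" for n
    proof -
      have "eta q (b + S n * z) (T n) - b = S n * z - T n * pen_deriv q (eta q (b + S n * z) (T n))"
        using eta_stationary[OF q1 q2, of "T n" "b + S n * z"] assms(3)[of n] by simp
      then show ?thesis using assms(2)[of n] by (simp add: diff_divide_distrib)
    qed
    ultimately show ?thesis by simp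
  qed
  have [measurable]: "pen_deriv q \<in> borel_measurable borel"
    by (intro borel_measurable_continuous_onI continuous_on_pen_deriv[OF q1 q2])
  have "1 = (\<integral>\<^sup>+ b. 1 \<partial>pb)" using pb.emeasure_space_1 by simp
  also have "\<dots> \<le> (\<integral>\<^sup>+ b. \<integral>\<^sup>+ z. ennreal ((z - a * pen_deriv q b)\<^sup>2) \<partial>std_normal_distribution \<partial>pb)"
    by (intro nn_integral_mono nn_integral_std_normal_shift)
  also have "\<dots> = (\<integral>\<^sup>+ (b, z). ennreal ((z - a * pen_deriv q b)\<^sup>2) \<partial>BZ_law pb)"
    by (subst normal.nn_integral_fst[symmetric]) auto
  also have "\<dots> = (\<integral>\<^sup>+ x. liminf (\<lambda>n. case x of (b, z) \<Rightarrow>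
      ennreal (((eta q (b + S n * z) (T n) - b) / S n)\<^sup>2)) \<partial>BZ_law pb)"
    by (intro nn_integral_cong)
       (auto intro!: lim_imp_Liminf[symmetric] tendsto_ennrealI lim)
  also have "\<dots> \<le> liminf (\<lambda>n. \<integral>\<^sup>+ (b, z). ennreal (((eta q (b + S n * z) (T n) - b) / S n)\<^sup>2) \<partial>BZ_law pb)"
    by (intro nn_integral_liminf measurable_sq_error less_imp_le assms)
  also have "\<dots> = liminf (\<lambda>n. ennreal (mse (S n) (T n) / (S n)\<^sup>2))"
    by (intro arg_cong[where f = liminf] ext nn_integral_sq_error) (use assms in \<open>auto intro: less_imp_le\<close>)
  finally show ?thesis .
qed

text \<open>
  For \<open>b \<noteq> 0\<close> the estimate is either at distance at least \<open>\<bar>b\<bar>/2\<close> from \<open>b\<close>, an error of order \<open>1/s\<close>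
  after normalization, or it stays away from \<open>0\<close>, so that the shrinkage \<open>(t/s) pen_deriv (\<eta>)\<close> is of
  order at least \<open>t/s\<close>. Either way the normalized error explodes.
\<close>

lemma ratio_unbounded_case:
  assumes "S \<longlonglongrightarrow> 0" "\<And>n. 0 < S n" "\<And>n. 0 < T n" "filterlim (\<lambda>n. T n / S n) at_top sequentially"
    and nz: "0 < measure pb (- {0})"
  shows "liminf (\<lambda>n. ennreal (mse (S n) (T n) / (S n)\<^sup>2)) = \<infinity>"
proof -
  have lim: "(\<lambda>n. ennreal (((eta q (b + S n * z) (T n) - b) / S n)\<^sup>2)) \<longlonglongrightarrow> \<infinity>" if b: "b \<noteq> 0" for b z
  proof -
    define k where "k = q * (\<bar>b\<bar> / 2) powr (q - 1)"
    have k: "0 < k" using b q1 by (simp add: k_def)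
    have "filterlim (\<lambda>n. inverse (S n)) at_top sequentially"
      by (intro filterlim_inverse_at_top assms(1) always_eventually allI assms(2))
    then have 1: "filterlim (\<lambda>n. (\<bar>b\<bar> / 2) * inverse (S n)) at_top sequentially"
      using b by (intro filterlim_tendsto_pos_mult_at_top[OF tendsto_const]) auto
    have 2: "filterlim (\<lambda>n. - \<bar>z\<bar> + k * (T n / S n)) at_top sequentially"
      by (intro filterlim_tendsto_add_at_top[OF tendsto_const]
          filterlim_tendsto_pos_mult_at_top[OF tendsto_const k assms(4)])
    have "filterlim (\<lambda>n. min ((\<bar>b\<bar> / 2) * inverse (S n)) (- \<bar>z\<bar> + k * (T n / S n))) at_top sequentially"
      unfolding filterlim_at_top
    proof
      fix Z :: real
      show "\<forall>\<^sub>F n in sequentially. Z \<le> min ((\<bar>b\<bar> / 2) * inverse (S n)) (- \<bar>z\<bar> + k * (T n / S n))"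
        using eventually_conj[OF filterlim_at_top[THEN iffD1, rule_format, OF 1, of Z]
            filterlim_at_top[THEN iffD1, rule_format, OF 2, of Z]]
        by (rule eventually_mono) auto
    qed
    moreover have "min ((\<bar>b\<bar> / 2) * inverse (S n)) (- \<bar>z\<bar> + k * (T n / S n))
        \<le> \<bar>(eta q (b + S n * z) (T n) - b) / S n\<bar>" for n
    proof (cases "\<bar>eta q (b + S n * z) (T n) - b\<bar> < \<bar>b\<bar> / 2")
      case False
      then have "(\<bar>b\<bar> / 2) / S n \<le> \<bar>eta q (b + S n * z) (T n) - b\<bar> / S n"
        using assms(2)[of n] by (intro divide_right_mono) auto
      also have "\<dots> = \<bar>(eta q (b + S n * z) (T n) - b) / S n\<bar>"
        using assms(2)[of n] by (simp add: abs_divide)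
      finally show ?thesis by (intro min.coboundedI1) (simp only: divide_inverse)
    next
      case True
      let ?x = "eta q (b + S n * z) (T n)"
      have "\<bar>b\<bar> / 2 \<le> \<bar>?x\<bar>"
        using True abs_triangle_ineq2[of b ?x] abs_minus_commute[of b ?x] by argo
      then have "k \<le> \<bar>pen_deriv q ?x\<bar>"
        unfolding k_def abs_pen_deriv[OF q1 q2] using q1 by (intro mult_left_mono powr_mono2) auto
      then have "T n * k \<le> T n * \<bar>pen_deriv q ?x\<bar>" using assms(3)[of n] by simp
      also have "\<dots> = \<bar>T n * pen_deriv q ?x\<bar>" using assms(3)[of n] by (simp add: abs_mult)
      also have "T n * pen_deriv q ?x = S n * z - (?x - b)"
        using eta_stationary[OF q1 q2, of "T n" "b + S n * z"] assms(3)[of n] by simp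
      also have "\<bar>S n * z - (?x - b)\<bar> \<le> S n * \<bar>z\<bar> + \<bar>?x - b\<bar>"
        using assms(2)[of n] abs_triangle_ineq4[of "S n * z" "?x - b"] by (simp add: abs_mult)
      finally have "T n * k - S n * \<bar>z\<bar> \<le> \<bar>?x - b\<bar>" by simp
      then have "(T n * k - S n * \<bar>z\<bar>) / S n \<le> \<bar>?x - b\<bar> / S n"
        using assms(2)[of n] by (intro divide_right_mono) auto
      also have "\<dots> = \<bar>(?x - b) / S n\<bar>"
        using assms(2)[of n] by (simp add: abs_divide)
      also have "(T n * k - S n * \<bar>z\<bar>) / S n = - \<bar>z\<bar> + k * (T n / S n)"
        using assms(2)[of n] by (simp add: field_simps)
      finally have "- \<bar>z\<bar> + k * (T n / S n) \<le> \<bar>(?x - b) / S n\<bar>" .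
      then show ?thesis by (rule min.coboundedI2)
    qed
    ultimately have "filterlim (\<lambda>n. \<bar>(eta q (b + S n * z) (T n) - b) / S n\<bar>) at_top sequentially"
      by (rule filterlim_at_top_mono[OF _ always_eventually[OF allI]])
    then have "filterlim (\<lambda>n. \<bar>(eta q (b + S n * z) (T n) - b) / S n\<bar> ^ 2) at_top sequentially"
      by (intro filterlim_pow_at_top) auto
    then show ?thesis
      by (simp only: power2_abs ennreal_tendsto_top_eq_at_top infinity_ennreal_def)
  qed
  have "\<infinity> * emeasure pb (- {0}) = \<infinity>"
    using nz by (simp add: pb.emeasure_eq_measure ennreal_top_mult)
  moreover have "\<infinity> * emeasure pb (- {0}) = (\<integral>\<^sup>+ b. \<infinity> * indicator (- {0}) b \<partial>pb)"
    by (subst nn_integral_cmult_indicator) auto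
  moreover have "\<dots> = (\<integral>\<^sup>+ b. \<integral>\<^sup>+ z. \<infinity> * indicator (- {0}) b \<partial>std_normal_distribution \<partial>pb)"
    using normal.emeasure_space_1 by (intro nn_integral_cong) (simp add: nn_integral_const)
  moreover have "\<dots> = (\<integral>\<^sup>+ (b, z). \<infinity> * indicator (- {0}) b \<partial>BZ_law pb)"
    by (subst normal.nn_integral_fst[symmetric]) auto
  moreover have "\<dots> \<le> (\<integral>\<^sup>+ x. liminf (\<lambda>n. case x of (b, z) \<Rightarrow>
      ennreal (((eta q (b + S n * z) (T n) - b) / S n)\<^sup>2)) \<partial>BZ_law pb)"
    by (intro nn_integral_mono)
       (auto simp: lim_imp_Liminf[OF _ lim] split: split_indicator)
  moreover have "\<dots> \<le> liminf (\<lambda>n. \<integral>\<^sup>+ (b, z). ennreal (((eta q (b + S n * z) (T n) - b) / S n)\<^sup>2) \<partial>BZ_law pb)"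
    by (intro nn_integral_liminf measurable_sq_error less_imp_le assms)
  moreover have "\<dots> = liminf (\<lambda>n. ennreal (mse (S n) (T n) / (S n)\<^sup>2))"
    by (intro arg_cong[where f = liminf] ext nn_integral_sq_error) (use assms in \<open>auto intro: less_imp_le\<close>)
  ultimately show ?thesis by (simp add: top_unique)
qed

text \<open>
  Otherwise there are noise levels tending to \<open>0\<close> with bad thresholds. By compactness of the
  extended reals the ratios \<open>t/s\<close> converge along a subsequence, to a finite or an infinite limit,
  and each case contradicts \<open>d < 1\<close>.
\<close>

lemma mse_not_below_noise:
  assumes nz: "0 < measure pb (- {0})" and d: "d < 1"
  shows "\<exists>s0>0. \<forall>s t. 0 < s \<longrightarrow> s < s0 \<longrightarrow> 0 < t \<longrightarrow> d * s\<^sup>2 < mse s t"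
proof (rule ccontr)
  assume "\<not> ?thesis"
  then have "\<forall>n. \<exists>s t. 0 < s \<and> s < inverse (real (Suc n)) \<and> 0 < t \<and> mse s t \<le> d * s\<^sup>2"
    by (metis inverse_positive_iff_positive not_less of_nat_0_less_iff zero_less_Suc)
  then obtain S T where ST: "\<And>n. 0 < S n" "\<And>n. S n < inverse (real (Suc n))" "\<And>n. 0 < T n"
      "\<And>n. mse (S n) (T n) \<le> d * (S n)\<^sup>2"
    by metis
  have S0: "S \<longlonglongrightarrow> 0"
    by (rule tendsto_sandwich[OF _ _ tendsto_const LIMSEQ_inverse_real_of_nat])
       (use ST in \<open>auto intro!: always_eventually less_imp_le\<close>)
  have ub: "ennreal (mse (S n) (T n) / (S n)\<^sup>2) \<le> ennreal d" for n
    using ST(1)[of n] ST(4)[of n] by (intro ennreal_leI) (simp add: divide_le_eq)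
  obtain l r where r: "strict_mono r" and l: "((\<lambda>n. ereal (T n / S n)) \<circ> r) \<longlonglongrightarrow> l"
    using seq_compactE[OF compact_imp_seq_compact[OF compact_UNIV], of "\<lambda>n. ereal (T n / S n)"]
    by blast
  have Sr: "(S \<circ> r) \<longlonglongrightarrow> 0" by (rule LIMSEQ_subseq_LIMSEQ[OF S0 r])
  have l0: "0 \<le> l" using ST(1,3)
    by (intro LIMSEQ_le_const[OF l]) (auto intro!: exI[of _ 0] less_imp_le)
  have "1 \<le> liminf (\<lambda>n. ennreal (mse ((S \<circ> r) n) ((T \<circ> r) n) / ((S \<circ> r) n)\<^sup>2))"
  proof (cases l)
    case (real a)
    then show ?thesis using l ST
      by (intro ratio_bounded_case[OF Sr, where a = a]) (auto simp: o_def)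
  next
    case PInf
    then show ?thesis using l ST
      by (subst ratio_unbounded_case[OF Sr _ _ _ nz]) (auto simp: o_def tendsto_PInfty_eq_at_top)
  next
    case MInf
    then show ?thesis using l0 by simp
  qed
  also have "\<dots> \<le> ennreal d"
    using ub by (intro Liminf_le) auto
  finally have "ennreal 1 \<le> ennreal d" by simp
  then show False using d by (subst (asm) ennreal_le_iff2) auto
qed

end

section \<open>Existence of estimators and the unpenalized case\<close>

text \<open>
  Gram--Schmidt: the residual of the new column after projection onto the previous ones is either
  zero, and the column adds nothing, or a new orthogonal direction to project on.
\<close>

lemma normal_equations_solvable:
  fixes x :: "nat \<Rightarrow> nat \<Rightarrow> real"
  shows "\<exists>b. \<forall>i<p. (\<Sum>j<n. x i j * (y j - (\<Sum>k<p. x k j * b k))) = 0"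
proof (induction p arbitrary: y)
  case 0
  then show ?case by simp
next
  case (Suc p)
  obtain b where b: "\<forall>i<p. (\<Sum>j<n. x i j * (y j - (\<Sum>k<p. x k j * b k))) = 0"
    using Suc.IH by blast
  obtain a where a: "\<forall>i<p. (\<Sum>j<n. x i j * (x p j - (\<Sum>k<p. x k j * a k))) = 0"
    using Suc.IH by blast
  define u where "u j = y j - (\<Sum>k<p. x k j * b k)" for j
  define r where "r j = x p j - (\<Sum>k<p. x k j * a k)" for j
  have u: "(\<Sum>j<n. x i j * u j) = 0" and r: "(\<Sum>j<n. x i j * r j) = 0" if "i < p" for i
    using a b that by (auto simp: u_def r_def)
  have split: "(\<Sum>j<n. x p j * w j) = (\<Sum>j<n. r j * w j)"
    if w: "\<And>i. i < p \<Longrightarrow> (\<Sum>j<n. x i j * w j) = 0" for w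
  proof -
    have "(\<Sum>j<n. x p j * w j) = (\<Sum>j<n. r j * w j + (\<Sum>k<p. a k * (x k j * w j)))"
      by (intro sum.cong refl)
        (simp add: r_def left_diff_distrib sum_distrib_right mult.assoc mult.left_commute[of "a _"])
    also have "\<dots> = (\<Sum>j<n. r j * w j) + (\<Sum>k<p. a k * (\<Sum>j<n. x k j * w j))"
      unfolding sum.distrib sum_distrib_left by (subst sum.swap) (rule refl)
    finally show ?thesis using w by simp
  qed
  \<comment> \<open>For a vanishing residual \<open>r\<close> the division by zero gives \<open>c = 0\<close>, and every value would do.\<close>
  define c where "c = (\<Sum>j<n. r j * u j) / (\<Sum>j<n. r j * r j)"
  have c: "(\<Sum>j<n. r j * (u j - c * r j)) = 0"
  proof (cases "(\<Sum>j<n. r j * r j) = 0")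
    case True
    then have "\<And>j. j < n \<Longrightarrow> r j = 0"
      by (subst (asm) sum_nonneg_eq_0_iff) auto
    then show ?thesis by simp
  next
    case False
    have "(\<Sum>j<n. r j * (u j - c * r j)) = (\<Sum>j<n. r j * u j) - c * (\<Sum>j<n. r j * r j)"
      by (simp add: right_diff_distrib sum_subtractf sum_distrib_left mult_ac)
    then show ?thesis using False by (simp add: c_def)
  qed
  define b' where "b' k = (if k < p then b k - c * a k else c)" for k
  have res: "y j - (\<Sum>k<Suc p. x k j * b' k) = u j - c * r j" for j
  proof -
    have "(\<Sum>k<p. x k j * b' k) = (\<Sum>k<p. x k j * b k) - c * (\<Sum>k<p. x k j * a k)"
      unfolding sum_distrib_left sum_subtractf[symmetric]
      by (intro sum.cong refl) (simp add: b'_def algebra_simps)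
    then show ?thesis by (simp add: b'_def u_def r_def algebra_simps)
  qed
  have old: "(\<Sum>j<n. x i j * (u j - c * r j)) = 0" if "i < p" for i
  proof -
    have "(\<Sum>j<n. x i j * (u j - c * r j)) = (\<Sum>j<n. x i j * u j) - c * (\<Sum>j<n. x i j * r j)"
      by (simp add: right_diff_distrib sum_subtractf sum_distrib_left mult_ac)
    then show ?thesis using u r that by simp
  qed
  have "\<forall>i<Suc p. (\<Sum>j<n. x i j * (y j - (\<Sum>k<Suc p. x k j * b' k))) = 0"
    unfolding res using old split[of "\<lambda>j. u j - c * r j"] c by (auto simp: less_Suc_eq)
  then show ?case by blast
qed

text \<open>
  Gaussian elimination: the last equation is either trivial or determines one unknown \<open>v m\<close> by the
  others. Working with an arbitrary finite index set lets the pivot be removed without renumbering.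
\<close>

lemma underdetermined_kernel:
  fixes A :: "nat \<Rightarrow> 'i \<Rightarrow> real"
  assumes "finite J" "n < card J"
  shows "\<exists>v. (\<exists>i\<in>J. v i \<noteq> 0) \<and> (\<forall>j<n. (\<Sum>i\<in>J. A j i * v i) = 0)"
  using assms
proof (induction n arbitrary: J A)
  case 0
  then have "J \<noteq> {}" by auto
  then show ?case by (intro exI[of _ "\<lambda>_. 1"]) auto
next
  case (Suc n)
  show ?case
  proof (cases "\<forall>i\<in>J. A n i = 0")
    case True
    obtain v where "\<exists>i\<in>J. v i \<noteq> 0" "\<forall>j<n. (\<Sum>i\<in>J. A j i * v i) = 0"
      using Suc.IH[of J A] Suc.prems by auto
    then show ?thesis using True by (intro exI[of _ v]) (auto simp: less_Suc_eq)
  next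
    case False
    then obtain m where m: "m \<in> J" "A n m \<noteq> 0" by blast
    let ?J = "J - {m}"
    obtain v where v: "\<exists>i\<in>?J. v i \<noteq> 0"
        "\<forall>j<n. (\<Sum>i\<in>?J. (A j i - A j m * A n i / A n m) * v i) = 0"
      using Suc.IH[of ?J "\<lambda>j i. A j i - A j m * A n i / A n m"] Suc.prems m
      by (auto simp: less_diff_conv)
    define h where "h = - (\<Sum>i\<in>?J. A n i * v i) / A n m"
    define v' where "v' = v(m := h)"
    have sum: "(\<Sum>i\<in>J. A j i * v' i) = A j m * h + (\<Sum>i\<in>?J. A j i * v i)" for j
      using sum.remove[OF Suc.prems(1) m(1), of "\<lambda>i. A j i * v' i"]
      by (simp add: v'_def cong: sum.cong_simp)
    have "(\<Sum>i\<in>J. A j i * v' i) = 0" if "j < n" for j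
    proof -
      have "0 = (\<Sum>i\<in>?J. A j i * v i - (A j m / A n m) * (A n i * v i))"
        using v(2) that by (simp add: algebra_simps)
      also have "\<dots> = (\<Sum>i\<in>?J. A j i * v i) + A j m * h"
        by (simp only: sum_subtractf sum_distrib_left[symmetric] h_def) simp
      finally show ?thesis unfolding sum by simp
    qed
    moreover have "(\<Sum>i\<in>J. A n i * v' i) = 0"
      unfolding sum using m by (simp add: h_def)
    moreover have "\<exists>i\<in>J. v' i \<noteq> 0" using v(1) by (auto simp: v'_def)
    ultimately show ?thesis by (intro exI[of _ v']) (auto simp: less_Suc_eq)
  qed
qed

lemma lq_objective_nonneg: "0 \<le> l \<Longrightarrow> 0 \<le> lq_objective I q l p \<omega> b"
  unfolding lq_objective_def by (intro add_nonneg_nonneg mult_nonneg_nonneg sum_nonneg) auto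

lemma unpenalized_minimizer_exists:
  "\<exists>b. is_arg_min (lq_objective I q 0 p \<omega>) (\<lambda>_. True) b"
proof -
  define y where "y = response I p \<omega>"
  define x where "x i j = dsg I p j i \<omega>" for i j
  define R where "R b j = y j - (\<Sum>k<p. x k j * b k)" for b j
  obtain b where b: "\<forall>i<p. (\<Sum>j<nobs I p. x i j * R b j) = 0"
    using normal_equations_solvable[of p x y "nobs I p"] unfolding R_def by blast
  have obj: "lq_objective I q 0 p \<omega> b = 1/2 * (\<Sum>j<nobs I p. (R b j)\<^sup>2)" for b
    by (simp add: lq_objective_def R_def y_def x_def)
  have "(\<Sum>j<nobs I p. (R b j)\<^sup>2) \<le> (\<Sum>j<nobs I p. (R b' j)\<^sup>2)" for b'
  proof -
    define d where "d k = b k - b' k" for k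
    have R': "R b' j = R b j + (\<Sum>k<p. x k j * d k)" for j
      by (simp add: R_def d_def right_diff_distrib sum_subtractf)
    have "(\<Sum>j<nobs I p. R b j * (\<Sum>k<p. x k j * d k)) = (\<Sum>k<p. d k * (\<Sum>j<nobs I p. x k j * R b j))"
      unfolding sum_distrib_left by (subst sum.swap) (simp add: mult_ac)
    then have orth: "(\<Sum>j<nobs I p. R b j * (\<Sum>k<p. x k j * d k)) = 0" using b by simp
    have "(\<Sum>j<nobs I p. (R b' j)\<^sup>2) = (\<Sum>j<nobs I p. (R b j)\<^sup>2)
        + 2 * (\<Sum>j<nobs I p. R b j * (\<Sum>k<p. x k j * d k)) + (\<Sum>j<nobs I p. (\<Sum>k<p. x k j * d k)\<^sup>2)"
      unfolding R' power2_sum by (simp add: sum.distrib sum_distrib_left mult.assoc)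
    then show ?thesis using orth by (simp add: sum_nonneg)
  qed
  then show ?thesis
    by (intro exI[of _ b]) (simp add: is_arg_min_linorder obj)
qed

text \<open>
  The penalty is coercive, so the search may be confined to a box, which is compact in the product
  topology on \<open>nat \<Rightarrow> real\<close> once the irrelevant coordinates are set to \<open>0\<close>.
\<close>

lemma penalized_minimizer_exists:
  assumes l: "0 < l" and q: "0 < q"
  shows "\<exists>b. is_arg_min (lq_objective I q l p \<omega>) (\<lambda>_. True) b"
proof -
  let ?f = "lq_objective I q l p \<omega>"
  define M where "M = ?f (\<lambda>_. 0) / l"
  have M: "0 \<le> M" using lq_objective_nonneg[of l I q p \<omega> "\<lambda>_. 0"] l by (simp add: M_def)
  \<comment> \<open>Chosen so that a single coordinate beyond \<open>R\<close> already costs more than the zero vector.\<close>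
  define R where "R = M powr (1 / q)"
  have R: "0 \<le> R" "R powr q = M" using q M by (auto simp: R_def powr_powr)
  define S where "S i = (if i < p then {-R..R} else {0})" for i :: nat
  let ?K = "PiE UNIV S"
  have "compactin (product_topology (\<lambda>_. euclidean) UNIV) ?K"
    unfolding compactin_PiE by (auto simp: S_def)
  then have "compact ?K" by (simp add: euclidean_product_topology)
  moreover have zero: "(\<lambda>_. 0) \<in> ?K" using R by (auto simp: S_def)
  moreover have "continuous_on ?K ?f"
  proof -
    have c: "continuous_on ?K (\<lambda>b. b i)" for i
      by (rule continuous_on_subset[OF continuous_on_product_coordinates]) auto
    show ?thesis
      unfolding lq_objective_def
      by (intro continuous_intros continuous_on_powr' c) (use q in auto)
  qed
  ultimately obtain b where b: "b \<in> ?K" "\<And>b'. b' \<in> ?K \<Longrightarrow> ?f b \<le> ?f b'"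
    using continuous_attains_inf[of ?K ?f] by blast
  have "?f b \<le> ?f b'" for b'
  proof (cases "\<exists>i<p. R < \<bar>b' i\<bar>")
    case True
    then obtain i where i: "i < p" "R < \<bar>b' i\<bar>" by blast
    have "?f b \<le> l * M" using b(2)[OF zero] l by (simp add: M_def)
    also have "\<dots> \<le> l * \<bar>b' i\<bar> powr q"
      using R i q l by (metis less_imp_le mult_left_mono powr_mono2)
    also have "\<dots> \<le> l * (\<Sum>i<p. \<bar>b' i\<bar> powr q)"
      using i l by (intro mult_left_mono member_le_sum) auto
    also have "\<dots> \<le> ?f b'" unfolding lq_objective_def by (simp add: sum_nonneg)
    finally show ?thesis .
  next
    case False
    define b'' where "b'' i = (if i < p then b' i else 0)" for i
    have "b'' \<in> ?K" using False by (auto simp: S_def b''_def) (use not_less in fastforce)+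
    moreover have "?f b'' = ?f b'" by (simp add: lq_objective_def b''_def)
    ultimately show ?thesis using b(2) by metis
  qed
  then show ?thesis
    by (intro exI[of _ b]) (simp add: is_arg_min_linorder)
qed

lemma lq_estimator_exists:
  assumes "0 < l" "0 < q"
  shows "\<exists>bhat. lq_estimator I q l bhat"
  unfolding lq_estimator_def
  by (rule exI[of _ "\<lambda>p \<omega>. SOME b. is_arg_min (lq_objective I q l p \<omega>) (\<lambda>_. True) b"])
    (blast intro: someI_ex[OF penalized_minimizer_exists[OF assms]])

text \<open>
  Existence of an estimator matters here: without one, \<open>has_AMSE\<close> would hold vacuously for every
  number.
\<close>

lemma has_AMSE_unique:
  assumes "prob_space (pspace I)" "0 < l" "0 < q" "has_AMSE I q l a" "has_AMSE I q l a'"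
  shows "a = a'"
proof -
  interpret prob_space "pspace I" by fact
  obtain bhat where "lq_estimator I q l bhat" using lq_estimator_exists assms(2,3) by blast
  then have "AE \<omega> in pspace I. (\<lambda>p. (\<Sum>i<p. (bhat p \<omega> i - sig I p i)\<^sup>2) / real p) \<longlonglongrightarrow> a"
    "AE \<omega> in pspace I. (\<lambda>p. (\<Sum>i<p. (bhat p \<omega> i - sig I p i)\<^sup>2) / real p) \<longlonglongrightarrow> a'"
    using assms(4,5) unfolding has_AMSE_def by blast+
  then have "AE \<omega> in pspace I. a = a'"
    by eventually_elim (rule LIMSEQ_unique)
  then show ?thesis by simp
qed

lemma AMSE_eq:
  assumes "prob_space (pspace I)" "0 < l" "0 < q" "has_AMSE I q l a"
  shows "AMSE I q l = a"
  unfolding AMSE_def by (rule the_equality) (use assms has_AMSE_unique in blast)+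

lemma far_unpenalized_minimizer:
  assumes "nobs I p < p"
  shows "\<exists>b. is_arg_min (lq_objective I q 0 p \<omega>) (\<lambda>_. True) b \<and> real p \<le> (\<Sum>i<p. (b i - sig I p i)\<^sup>2) / real p"
proof -
  obtain b where b: "is_arg_min (lq_objective I q 0 p \<omega>) (\<lambda>_. True) b"
    using unpenalized_minimizer_exists[of I q p \<omega>] by blast
  obtain v m where v: "m < p" "v m \<noteq> 0" "\<And>j. j < nobs I p \<Longrightarrow> (\<Sum>i<p. dsg I p j i \<omega> * v i) = 0"
    using underdetermined_kernel[of "{..<p}" "nobs I p" "\<lambda>j i. dsg I p j i \<omega>"] assms by auto
  \<comment> \<open>This makes the error in coordinate \<open>m\<close> equal to \<open>p\<close>, hence the mean square error at least \<open>p\<close>.\<close>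
  define r where "r = (real p - (b m - sig I p m)) / v m"
  define b' where "b' i = b i + r * v i" for i
  have "(\<Sum>i<p. dsg I p j i \<omega> * b' i) = (\<Sum>i<p. dsg I p j i \<omega> * b i)" if "j < nobs I p" for j
  proof -
    have "(\<Sum>i<p. dsg I p j i \<omega> * b' i) = (\<Sum>i<p. dsg I p j i \<omega> * b i) + r * (\<Sum>i<p. dsg I p j i \<omega> * v i)"
      unfolding sum_distrib_left sum.distrib[symmetric]
      by (intro sum.cong refl) (simp add: b'_def algebra_simps)
    then show ?thesis using v(3)[OF that] by simp
  qed
  then have "lq_objective I q 0 p \<omega> b' = lq_objective I q 0 p \<omega> b"
    by (simp add: lq_objective_def)
  then have "is_arg_min (lq_objective I q 0 p \<omega>) (\<lambda>_. True) b'"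
    using b by (simp add: is_arg_min_def)
  moreover have "real p \<le> (\<Sum>i<p. (b' i - sig I p i)\<^sup>2) / real p"
  proof -
    have "b' m - sig I p m = real p" using v(2) by (simp add: b'_def r_def)
    then have "(real p)\<^sup>2 \<le> (\<Sum>i<p. (b' i - sig I p i)\<^sup>2)"
      using member_le_sum[of m "{..<p}" "\<lambda>i. (b' i - sig I p i)\<^sup>2"] v(1) by simp
    then show ?thesis using v(1) by (simp add: le_divide_eq power2_eq_square)
  qed
  ultimately show ?thesis by blast
qed

text \<open>
  Eventually \<open>n(p) < p\<close>, so a kernel vector of the design can be added to a least-squares solution.
  Scaling it suitably produces an estimator whose error diverges for every outcome.
\<close>

lemma no_AMSE_without_penalty:
  assumes "prob_space (pspace I)" "(\<lambda>p. real (nobs I p) / real p) \<longlonglongrightarrow> \<delta>" "\<delta> < 1"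
  shows "\<not> has_AMSE I q 0 a"
proof
  assume has: "has_AMSE I q 0 a"
  interpret prob_space "pspace I" by fact
  let ?P = "\<lambda>p \<omega> b. is_arg_min (lq_objective I q 0 p \<omega>) (\<lambda>_. True) b \<and>
      (nobs I p < p \<longrightarrow> real p \<le> (\<Sum>i<p. (b i - sig I p i)\<^sup>2) / real p)"
  have "\<exists>b. ?P p \<omega> b" for p \<omega>
    using far_unpenalized_minimizer[of I p q \<omega>] unpenalized_minimizer_exists[of I q p \<omega>]
    by (cases "nobs I p < p") blast+
  then obtain bhat where bhat: "\<And>p \<omega>. ?P p \<omega> (bhat p \<omega>)" by metis
  have "lq_estimator I q 0 bhat" using bhat by (simp add: lq_estimator_def)
  then have "AE \<omega> in pspace I. (\<lambda>p. (\<Sum>i<p. (bhat p \<omega> i - sig I p i)\<^sup>2) / real p) \<longlonglongrightarrow> a"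
    using has unfolding has_AMSE_def by blast
  moreover have "\<not> (\<lambda>p. (\<Sum>i<p. (bhat p \<omega> i - sig I p i)\<^sup>2) / real p) \<longlonglongrightarrow> a" for \<omega>
  proof
    assume lim: "(\<lambda>p. (\<Sum>i<p. (bhat p \<omega> i - sig I p i)\<^sup>2) / real p) \<longlonglongrightarrow> a"
    have "\<forall>\<^sub>F p in sequentially. real (nobs I p) / real p < 1"
      using order_tendstoD(2)[OF assms(2,3)] .
    then have "\<forall>\<^sub>F p in sequentially. real p \<le> (\<Sum>i<p. (bhat p \<omega> i - sig I p i)\<^sup>2) / real p"
      using eventually_gt_at_top[of 0]
      by eventually_elim (use bhat in \<open>auto simp: divide_less_eq\<close>)
    then have "filterlim (\<lambda>p. (\<Sum>i<p. (bhat p \<omega> i - sig I p i)\<^sup>2) / real p) at_top sequentially"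
      by (rule filterlim_at_top_mono[OF filterlim_real_sequentially])
    then show False
      using lim not_tendsto_and_filterlim_at_infinity[OF sequentially_bot]
        filterlim_at_top_imp_at_infinity by blast
  qed
  ultimately show False by simp
qed

section \<open>The second moment of a mixture with an atom at zero\<close>

lemma mixture_weight_off_atom:
  fixes g pb :: "real measure"
  assumes "real_distribution g" "measure g {0} = 0"
    and mix: "\<And>A. A \<in> sets borel \<Longrightarrow>
           measure pb A = (1 - \<epsilon>) * measure (return borel 0) A + \<epsilon> * measure g A"
  shows "measure pb (- {0}) = \<epsilon>"
proof -
  interpret g: real_distribution g by fact
  have "measure g (- {0}) = 1"
    using g.prob_compl[of "{0}"] assms(2) by (simp add: Compl_eq_Diff_UNIV)
  then show ?thesis using mix[of "- {0}"] by (simp add: measure_return)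
qed

text \<open>
  Away from \<open>0\<close> the mixture is \<open>\<epsilon> g\<close>. Reading \<open>g\<close> as a density with respect to \<open>pb\<close> transfers
  integrability from \<open>g\<close> to \<open>pb\<close>.
\<close>

lemma mixture_component_density:
  fixes g pb :: "real measure"
  assumes e: "0 < \<epsilon>" and "real_distribution g" "measure g {0} = 0" "real_distribution pb"
    and mix: "\<And>A. A \<in> sets borel \<Longrightarrow>
           measure pb A = (1 - \<epsilon>) * measure (return borel 0) A + \<epsilon> * measure g A"
  shows "density pb (\<lambda>x. ennreal (indicator (- {0}) x / \<epsilon>)) = g"
proof (rule measure_eqI)
  interpret g: real_distribution g by fact
  interpret pb: real_distribution pb by fact
  show "sets (density pb (\<lambda>x. ennreal (indicator (- {0}) x / \<epsilon>))) = sets g" by simp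
  fix A assume "A \<in> sets (density pb (\<lambda>x. ennreal (indicator (- {0}) x / \<epsilon>)))"
  then have A [measurable]: "A \<in> sets borel" by simp
  have "emeasure (density pb (\<lambda>x. ennreal (indicator (- {0}) x / \<epsilon>))) A
      = (\<integral>\<^sup>+ x. ennreal (1 / \<epsilon>) * indicator (A - {0}) x \<partial>pb)"
    by (subst emeasure_density) (auto intro!: nn_integral_cong split: split_indicator)
  also have "\<dots> = ennreal (1 / \<epsilon>) * emeasure pb (A - {0})"
    by (subst nn_integral_cmult_indicator) auto
  also have "\<dots> = ennreal (1 / \<epsilon> * measure pb (A - {0}))"
    using e by (simp add: pb.emeasure_eq_measure ennreal_mult[symmetric])
  also have "1 / \<epsilon> * measure pb (A - {0}) = measure g (A - {0})"
    using mix[of "A - {0}"] e by (simp add: measure_return)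
  also have "measure g (A - {0}) = measure g A"
    by (rule measure_Diff_null_set) (use assms(3) in \<open>auto simp: null_sets_def g.emeasure_eq_measure\<close>)
  finally show "emeasure (density pb (\<lambda>x. ennreal (indicator (- {0}) x / \<epsilon>))) A = emeasure g A"
    by (simp add: g.emeasure_eq_measure)
qed

lemma mixture_second_moment:
  fixes g pb :: "real measure"
  assumes e: "0 < \<epsilon>" and "real_distribution g" "measure g {0} = 0" "real_distribution pb"
    and mix: "\<And>A. A \<in> sets borel \<Longrightarrow>
           measure pb A = (1 - \<epsilon>) * measure (return borel 0) A + \<epsilon> * measure g A"
    and int: "integrable g (\<lambda>x. x\<^sup>2)"
  shows "integrable pb (\<lambda>x. x\<^sup>2)"
proof -
  interpret pb: real_distribution pb by fact
  have "density pb (\<lambda>x. ennreal (indicator (- {0}) x / \<epsilon>)) = g"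
    using e assms(2-4) mix by (rule mixture_component_density)
  then have "integrable (density pb (\<lambda>x. ennreal (indicator (- {0}) x / \<epsilon>))) (\<lambda>x. x\<^sup>2)"
    using int by (simp only:)
  then have "integrable pb (\<lambda>x. (indicator (- {0}) x / \<epsilon>) *\<^sub>R x\<^sup>2)"
    using e by (subst (asm) integrable_density) auto
  then have "integrable pb (\<lambda>x. \<epsilon> * ((indicator (- {0}) x / \<epsilon>) *\<^sub>R x\<^sup>2))"
    by (rule integrable_mult_right)
  also have "(\<lambda>x. \<epsilon> * ((indicator (- {0}) x / \<epsilon>) *\<^sub>R x\<^sup>2)) = (\<lambda>x::real. x\<^sup>2)"
    using e by (auto split: split_indicator)
  finally show ?thesis .
qed

section \<open>The least effective noise level\<close>

context scalar_channel
begin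

text \<open>
  \<open>s\<close> is the first component of a state evolution solution at noise level \<open>sw\<close> for some positive
  penalty level: the two lemmas on \<open>se_solution\<close> below make this precise.
\<close>

definition fixed_point :: "real \<Rightarrow> real \<Rightarrow> real \<Rightarrow> bool" where
  "fixed_point \<delta> sw s \<longleftrightarrow> 0 < s \<and> (\<exists>t>0. mean_slope s t < \<delta> \<and> mse s t = \<delta> * (s\<^sup>2 - sw\<^sup>2))"

text \<open>
  The levels \<open>s\<close> that occur as fixed points for some \<open>sw > 0\<close>: since \<open>sw\<close> can be read off from
  \<open>mse s t = \<delta> (s\<^sup>2 - sw\<^sup>2)\<close>, only the inequality remains.
\<close>

definition noise_levels :: "real \<Rightarrow> real set" where
  "noise_levels \<delta> = {s. 0 < s \<and> (\<exists>t>0. mean_slope s t < \<delta> \<and> mse s t < \<delta> * s\<^sup>2)}"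

lemma scalar_mse_eq: "scalar_mse pb q s c = mse s (c * s powr (2 - q))"
  by (simp add: scalar_mse_def mse_def)

lemma se_solution_iff:
  "se_solution \<delta> pb q sw l (s, c) \<longleftrightarrow> 0 < s \<and> 0 < c \<and>
     s\<^sup>2 = sw\<^sup>2 + (1 / \<delta>) * mse s (c * s powr (2 - q)) \<and>
     l = c * s powr (2 - q) * (1 - (1 / \<delta>) * mean_slope s (c * s powr (2 - q)))"
  by (simp add: se_solution_def scalar_mse_eq mean_slope_def)

lemma fixed_point_of_se_solution:
  assumes "0 < \<delta>" "0 < l" "se_solution \<delta> pb q sw l (s, c)"
  shows "fixed_point \<delta> sw s" "scalar_mse pb q s c = \<delta> * (s\<^sup>2 - sw\<^sup>2)"
proof -
  define t where "t = c * s powr (2 - q)"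
  have s: "0 < s" "0 < t" "s\<^sup>2 = sw\<^sup>2 + (1 / \<delta>) * mse s t" "l = t * (1 - (1 / \<delta>) * mean_slope s t)"
    using assms(3) by (auto simp: se_solution_iff t_def)
  have m: "mse s t = \<delta> * (s\<^sup>2 - sw\<^sup>2)" using s(3) assms(1) by (simp add: field_simps)
  then show "scalar_mse pb q s c = \<delta> * (s\<^sup>2 - sw\<^sup>2)" by (simp add: scalar_mse_eq t_def)
  have "0 < 1 - (1 / \<delta>) * mean_slope s t" using s(2,4) assms(2) by (simp add: zero_less_mult_iff)
  then have "mean_slope s t < \<delta>" using assms(1) by (simp add: field_simps)
  then show "fixed_point \<delta> sw s" unfolding fixed_point_def using s m by blast
qed

lemma se_solution_of_fixed_point:
  assumes "0 < \<delta>" "fixed_point \<delta> sw s"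
  shows "\<exists>l>0. \<exists>c. se_solution \<delta> pb q sw l (s, c) \<and> scalar_mse pb q s c = \<delta> * (s\<^sup>2 - sw\<^sup>2)"
proof -
  obtain t where t: "0 < s" "0 < t" "mean_slope s t < \<delta>" "mse s t = \<delta> * (s\<^sup>2 - sw\<^sup>2)"
    using assms(2) by (auto simp: fixed_point_def)
  define c where "c = t / s powr (2 - q)"
  have c: "c * s powr (2 - q) = t" "0 < c" using t by (auto simp: c_def)
  have "0 < t * (1 - (1 / \<delta>) * mean_slope s t)" using t assms(1) by (simp add: field_simps)
  moreover have "se_solution \<delta> pb q sw (t * (1 - (1 / \<delta>) * mean_slope s t)) (s, c)"
    using t c assms(1) by (simp add: se_solution_iff)
  moreover have "scalar_mse pb q s c = \<delta> * (s\<^sup>2 - sw\<^sup>2)" using c t by (simp add: scalar_mse_eq)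
  ultimately show ?thesis by blast
qed

lemma fixed_point_in_noise_levels:
  assumes "0 < \<delta>" "0 < sw" "fixed_point \<delta> sw s"
  shows "s \<in> noise_levels \<delta>"
proof -
  have "\<delta> * (s\<^sup>2 - sw\<^sup>2) < \<delta> * s\<^sup>2" using assms by simp
  then show ?thesis using assms(3) unfolding fixed_point_def noise_levels_def by force
qed

text \<open>
  This replaces a monotonicity statement in \<open>sw\<close>. With \<open>sw\<close> fixed, the intermediate value theorem is
  applied along a path from the given point to one with \<open>s = sw\<close>. Moving straight down in \<open>s\<close> could
  violate \<open>mean_slope s t < \<delta>\<close>; raising the threshold first prevents this.
\<close>

lemma fixed_point_below_noise_level:
  assumes d: "0 < \<delta>" and s1: "s1 \<in> noise_levels \<delta>"
  shows "\<exists>v>0. \<forall>sw. 0 < sw \<longrightarrow> sw < v \<longrightarrow> (\<exists>s\<le>s1. fixed_point \<delta> sw s)"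
proof -
  obtain t1 where t1: "0 < s1" "0 < t1" "mean_slope s1 t1 < \<delta>" "mse s1 t1 < \<delta> * s1\<^sup>2"
    using s1 by (auto simp: noise_levels_def)
  \<comment> \<open>The noise level for which \<open>s1\<close> itself is a fixed point, with threshold \<open>t1\<close>.\<close>
  define v where "v = sqrt (s1\<^sup>2 - mse s1 t1 / \<delta>)"
  have pos: "0 < s1\<^sup>2 - mse s1 t1 / \<delta>" using t1 d by (simp add: field_simps)
  obtain C where C: "\<And>t s. C \<le> t \<Longrightarrow> 0 < t \<Longrightarrow> 0 \<le> s \<Longrightarrow> s \<le> s1 \<Longrightarrow> mean_slope s t < \<delta>"
    using mean_slope_small[OF d, of s1] by blast
  define t2 where "t2 = max C t1"
  have t2: "t1 \<le> t2" "C \<le> t2" "0 < t2" using t1 by (auto simp: t2_def)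
  have "\<exists>s\<le>s1. fixed_point \<delta> sw s" if sw: "0 < sw" "sw < v" for sw
  proof -
    define G where "G s t = \<delta> * (s\<^sup>2 - sw\<^sup>2) - mse s t" for s t
    have "sw\<^sup>2 < v\<^sup>2" using sw by (intro power_strict_mono) auto
    then have "sw\<^sup>2 < s1\<^sup>2 - mse s1 t1 / \<delta>" using pos by (simp add: v_def)
    then have G1: "0 < G s1 t1" using d by (simp add: G_def field_simps)
    have "sw\<^sup>2 < s1\<^sup>2"
    proof -
      have "0 \<le> mse s1 t1 / \<delta>" using d mse_nonneg by simp
      then show ?thesis using \<open>sw\<^sup>2 < s1\<^sup>2 - mse s1 t1 / \<delta>\<close> by linarith
    qed
    then have sws1: "sw \<le> s1" using t1(1) power2_less_imp_less[of sw s1] by simp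
    \<comment> \<open>A zero of \<open>G\<close> lies on the path \<open>(s1, t1) \<rightarrow> (s1, t2) \<rightarrow> (sw, t2)\<close>.\<close>
    show ?thesis
    proof (cases "G s1 t2 \<le> 0")
      case True
      have "\<exists>t\<ge>t1. t \<le> t2 \<and> G s1 t = 0"
        using True G1 t1(2) t2(1) unfolding G_def
        by (intro IVT2') (auto intro!: continuous_intros continuous_on_mse)
      then obtain t where t: "t1 \<le> t" "G s1 t = 0" by blast
      have "mean_slope s1 t < \<delta>" using mean_slope_antimono[OF t1(2) t(1)] t1(3) by (rule le_less_trans)
      then have "fixed_point \<delta> sw s1"
        unfolding fixed_point_def using t t1 by (auto simp: G_def intro!: exI[of _ t])
      then show ?thesis by blast
    next
      case False
      have "G sw t2 \<le> 0" using mse_nonneg by (simp add: G_def)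
      then have "\<exists>s\<ge>sw. s \<le> s1 \<and> G s t2 = 0"
        using False sws1 t2(3) unfolding G_def
        by (intro IVT') (auto intro!: continuous_intros continuous_on_mse)
      then obtain s where s: "sw \<le> s" "s \<le> s1" "G s t2 = 0" by blast
      then have "fixed_point \<delta> sw s"
        unfolding fixed_point_def using sw t2 C[of t2 s] by (auto simp: G_def intro!: exI[of _ t2])
      then show ?thesis using s by blast
    qed
  qed
  moreover have "0 < v" using pos by (simp add: v_def)
  ultimately show ?thesis by blast
qed

text \<open>
  The limit is the infimum of \<open>noise_levels \<delta>\<close>: all fixed points lie in this set, and each of its
  elements eventually bounds the least fixed point from above.
\<close>

lemma least_fixed_point_tendsto:
  assumes d: "0 < \<delta>" "\<delta> < 1" and nz: "0 < measure pb (- {0})"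
    and fp: "\<And>sw. 0 < sw \<Longrightarrow> fixed_point \<delta> sw (s sw)"
    and least: "\<And>sw s'. 0 < sw \<Longrightarrow> fixed_point \<delta> sw s' \<Longrightarrow> s sw \<le> s'"
  shows "\<exists>s0>0. (s \<longlongrightarrow> s0) (at_right 0)"
proof -
  let ?N = "noise_levels \<delta>"
  obtain e where e: "0 < e" "\<And>s t. 0 < s \<Longrightarrow> s < e \<Longrightarrow> 0 < t \<Longrightarrow> \<delta> * s\<^sup>2 < mse s t"
    using mse_not_below_noise[OF nz d(2)] by blast
  have lb: "e \<le> x" if "x \<in> ?N" for x
    using that e(2)[of x] by (force simp: noise_levels_def)
  have inN: "s sw \<in> ?N" if "0 < sw" for sw
    using fixed_point_in_noise_levels[OF d(1) that fp[OF that]] .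
  have ne: "?N \<noteq> {}" using inN[of 1] by auto
  have bdd: "bdd_below ?N" using lb by (rule bdd_belowI)
  have "(s \<longlongrightarrow> Inf ?N) (at_right 0)"
  proof (rule order_tendstoI)
    fix a assume "a < Inf ?N"
    then have "a < s sw" if "0 < sw" for sw
      using cInf_lower[OF inN[OF that] bdd] by linarith
    then show "\<forall>\<^sub>F sw in at_right 0. a < s sw"
      by (intro eventually_at_rightI[of 0 1]) auto
  next
    fix a assume "Inf ?N < a"
    then obtain s1 where s1: "s1 \<in> ?N" "s1 < a" using cInf_lessD[OF ne] by blast
    obtain v where v: "0 < v" "\<And>sw. 0 < sw \<Longrightarrow> sw < v \<Longrightarrow> \<exists>s\<le>s1. fixed_point \<delta> sw s"
      using fixed_point_below_noise_level[OF d(1) s1(1)] by blast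
    have "s sw < a" if "0 < sw" "sw < v" for sw
      using v(2)[OF that] least[OF that(1)] s1(2) by fastforce
    then show "\<forall>\<^sub>F sw in at_right 0. s sw < a"
      using v(1) by (intro eventually_at_rightI[of 0 v]) auto
  qed
  moreover have "0 < Inf ?N" using e(1) cInf_greatest[OF ne lb] by linarith
  ultimately show ?thesis by blast
qed

text \<open>
  At a fixed point the error is \<open>\<delta> (s\<^sup>2 - sw\<^sup>2)\<close>, which increases with \<open>s\<close>; so minimizing the error
  over \<open>\<lambda> > 0\<close> is the same as minimizing \<open>s\<close> over all fixed points.
\<close>

lemma optimal_lambda_least_fixed_point:
  assumes d: "0 < \<delta>" "\<delta> < 1" and sw: "0 < sw"
    and conv: "converging_sequence \<delta> pb sw I" and se: "state_evolution \<delta> pb q sw I"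
    and opt: "optimal_lambda I q l"
  shows "\<exists>s. fixed_point \<delta> sw s \<and> AMSE I q l = \<delta> * (s\<^sup>2 - sw\<^sup>2) \<and>
           (\<forall>s'. fixed_point \<delta> sw s' \<longrightarrow> s \<le> s')"
proof -
  have prob: "prob_space (pspace I)" and ratio: "(\<lambda>p. real (nobs I p) / real p) \<longlonglongrightarrow> \<delta>"
    using conv by (auto simp: converging_sequence_def)
  have q0: "0 < q" using q1 by simp
  have l: "0 \<le> l" "\<exists>a. has_AMSE I q l a"
    and opt': "\<And>l'. 0 \<le> l' \<Longrightarrow> \<exists>a. has_AMSE I q l' a \<Longrightarrow> AMSE I q l \<le> AMSE I q l'"
    using opt unfolding optimal_lambda_def is_arg_min_linorder by blast+
  have "l \<noteq> 0" using no_AMSE_without_penalty[OF prob ratio d(2)] l(2) by blast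
  then have lpos: "0 < l" using l(1) by simp
  have val: "AMSE I q l' = scalar_mse pb q s c" "has_AMSE I q l' (scalar_mse pb q s c)"
    if "0 < l'" "se_solution \<delta> pb q sw l' (s, c)" for l' s c
    using se that AMSE_eq[OF prob that(1) q0] unfolding state_evolution_def by blast+
  obtain s c where sc: "se_solution \<delta> pb q sw l (s, c)"
    using se lpos unfolding state_evolution_def by (metis surj_pair)
  have fp: "fixed_point \<delta> sw s" and amse: "AMSE I q l = \<delta> * (s\<^sup>2 - sw\<^sup>2)"
    using fixed_point_of_se_solution[OF d(1) lpos sc] unfolding val(1)[OF lpos sc] by blast+
  have "s \<le> s'" if fp': "fixed_point \<delta> sw s'" for s'
  proof -
    obtain l' c' where l': "0 < l'" "se_solution \<delta> pb q sw l' (s', c')"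
        "scalar_mse pb q s' c' = \<delta> * (s'\<^sup>2 - sw\<^sup>2)"
      using se_solution_of_fixed_point[OF d(1) fp'] by blast
    have "AMSE I q l \<le> AMSE I q l'" using opt'[of l'] val(2)[OF l'(1,2)] l'(1) by auto
    then have "\<delta> * (s\<^sup>2 - sw\<^sup>2) \<le> \<delta> * (s'\<^sup>2 - sw\<^sup>2)" using amse val(1)[OF l'(1,2)] l'(3) by simp
    then have "s\<^sup>2 \<le> s'\<^sup>2" using d(1) by simp
    moreover have "0 \<le> s'" using fp' by (simp add: fixed_point_def)
    ultimately show ?thesis by (rule power2_le_imp_le)
  qed
  then show ?thesis using fp amse by (intro exI[of _ s]) simp
qed

end

theorem theorem3p2:
  fixes \<epsilon> \<delta> q :: real
    and g pb :: "real measure"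
    and I :: "real \<Rightarrow> 'w lq_instance"
    and lstar :: "real \<Rightarrow> real"
  assumes "0 < \<epsilon>" "\<epsilon> < 1"
    and "real_distribution g" "measure g {0} = 0" "integrable g (\<lambda>x. x\<^sup>2)"
    and "real_distribution pb"
    and "\<And>A. A \<in> sets borel \<Longrightarrow>
           measure pb A = (1 - \<epsilon>) * measure (return borel 0) A + \<epsilon> * measure g A"
    and "1 < q" "q \<le> 2"
    and "0 < \<delta>" "\<delta> < 1"
    and "\<And>sw. 0 < sw \<Longrightarrow> converging_sequence \<delta> pb sw (I sw)"
    and "\<And>sw. 0 < sw \<Longrightarrow> state_evolution \<delta> pb q sw (I sw)"
    and "\<And>sw. 0 < sw \<Longrightarrow> optimal_lambda (I sw) q (lstar sw)"
  shows "\<exists>L>0. ((\<lambda>sw. AMSE (I sw) q (lstar sw)) \<longlongrightarrow> L) (at_right 0)"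
proof -
  have "integrable pb (\<lambda>b. b\<^sup>2)"
    by (rule mixture_second_moment[OF assms(1,3,4,6,7,5)])
  then interpret scalar_channel pb q
    using assms(6,8,9) by (simp add: scalar_channel_def scalar_channel_axioms_def)
  have nz: "0 < measure pb (- {0})"
    using mixture_weight_off_atom[OF assms(3,4,7)] assms(1) by simp
  obtain s where s: "\<And>sw. 0 < sw \<Longrightarrow> fixed_point \<delta> sw (s sw)"
      "\<And>sw. 0 < sw \<Longrightarrow> AMSE (I sw) q (lstar sw) = \<delta> * ((s sw)\<^sup>2 - sw\<^sup>2)"
      "\<And>sw s'. 0 < sw \<Longrightarrow> fixed_point \<delta> sw s' \<Longrightarrow> s sw \<le> s'"
    using optimal_lambda_least_fixed_point[OF assms(10,11) _ assms(12-14)] by metis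
  obtain s0 where s0: "0 < s0" "(s \<longlongrightarrow> s0) (at_right 0)"
    using least_fixed_point_tendsto[OF assms(10,11) nz s(1,3)] by blast
  have "((\<lambda>sw. \<delta> * ((s sw)\<^sup>2 - sw\<^sup>2)) \<longlongrightarrow> \<delta> * (s0\<^sup>2 - 0\<^sup>2)) (at_right 0)"
    by (intro tendsto_intros s0)
  moreover have "\<forall>\<^sub>F sw in at_right 0. \<delta> * ((s sw)\<^sup>2 - sw\<^sup>2) = AMSE (I sw) q (lstar sw)"
    using s(2) by (intro eventually_at_rightI[of 0 1]) auto
  ultimately have "((\<lambda>sw. AMSE (I sw) q (lstar sw)) \<longlongrightarrow> \<delta> * (s0\<^sup>2 - 0\<^sup>2)) (at_right 0)"
    by (rule Lim_transform_eventually)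
  then show ?thesis using s0(1) assms(10) by (intro exI[of _ "\<delta> * (s0\<^sup>2 - 0\<^sup>2)"]) simp
qed

end
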